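(* Let $a<b$, let $0<\alpha,\beta\le 1$ with $\alpha+\beta>1$, and let $\psi\in C^1[a,b]$ with $\psi'(t)>0$ for all $t\in[a,b]$. Suppose that there exists $\kappa\in(0,1)$ such that $|\mathcal{G}(x)|\le\kappa|x|$ for any $x\in\mathbb{R}$. Suppose further that $\lambda$ is an eigenvalue of the problem $$\left({}^C D_{a+}^{\alpha,\psi}\,{}^C D_{a+}^{\beta,\psi}x\right)(t)=\lambda x(t),\quad a<t<b,\qquad x(a)=0,\quad x(b)=\mathcal{G}(x).$$ Then $$|\lambda|\ge\frac{1-\kappa}{G_{\max}\,(\psi(b)-\psi(a))},$$ where $$G_{\max}=\frac{1}{\Gamma(\alpha+\beta)}(\psi(b)-\psi(a))^{\alpha+\beta-1}\max\left\{\beta^\beta(\alpha+\beta-1)^{\alpha+\beta-1},\ \frac{\beta(\alpha+\beta-1)^{\frac{\alpha+\beta-1}{\beta}}}{(\alpha+2\beta-1)^{\frac{\alpha+2\beta-1}{\beta}}}\right\}.$$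
   Context: $\|x\|=\sup_{a\le t\le b}|x(t)|$ for $x\in C[a,b]$; $\Gamma$ is the Gamma function. In the boundary condition $\mathcal{G}$ is applied to the unknown function $x\in C[a,b]$ and $\mathcal{G}(x)$ is a real number; for such $x$ the bound on $\mathcal{G}$ is used in the form $|\mathcal{G}(x)|\le\kappa\|x\|$. ${}^C D_{a+}^{\gamma,\psi}$ denotes the left $\psi$-Caputo fractional derivative, ${}^C D_{a+}^{\gamma,\psi}y=I_{a+}^{1-\gamma,\psi}(y'/\psi')$ for $0<\gamma\le1$, where $I_{a+}^{\gamma,\psi}y(t)=\frac{1}{\Gamma(\gamma)}\int_a^t\psi'(\tau)(\psi(t)-\psi(\tau))^{\gamma-1}y(\tau)\,d\tau$ for $\gamma>0$ and $I_{a+}^{0,\psi}$ is the identity. $\lambda$ is an eigenvalue of the problem if the problem has a nontrivial (not identically zero) mild solution. A mild solution of the problem ${}^C D_{a+}^{\alpha,\psi}\,{}^C D_{a+}^{\beta,\psi}x+f(t,x)=0$, $x(a)=0$, $x(b)=\mathcal{G}(x)$ (here with $f(t,x)=-\lambda x$) is a function $x\in C[a,b]$ satisfying $$x(t)=\left(\frac{\psi(t)-\psi(a)}{\psi(b)-\psi(a)}\right)^{\beta}\mathcal{G}(x)+\int_a^b G(\tau,t)\,\psi'(\tau)\,f(\tau,x(\tau))\,d\tau,$$ where $$G(\tau,t)=\begin{cases} C(\psi(t)-\psi(a))^\beta(\psi(b)-\psi(\tau))^{\alpha+\beta-1}-D(\psi(t)-\psi(\tau))^{\alpha+\beta-1},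 & a\le\tau\le t\le b,\\ C(\psi(t)-\psi(a))^\beta(\psi(b)-\psi(\tau))^{\alpha+\beta-1}, & a\le t\le\tau\le b,\end{cases}$$ with $C=\frac{1}{\Gamma(\alpha+\beta)(\psi(b)-\psi(a))^{\beta}}$ and $D=\frac{1}{\Gamma(\alpha+\beta)}$. *)

theory Defs
  imports "HOL-Analysis.Analysis" "HOL-Library.FuncSet"
begin

text \<open>The Banach space \<open>C[a,b]\<close> as a carrier set. Extensionality outside \<open>[a,b]\<close> makes its
  members correspond one-to-one to the continuous functions on \<open>[a,b]\<close>, so that a functional
  on this carrier cannot depend on values outside the interval.\<close>

definition C_space :: "real \<Rightarrow> real \<Rightarrow> (real \<Rightarrow> real) set" where
  "C_space a b = {x. x \<in> extensional {a..b} \<and> continuous_on {a..b} x}"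

definition sup_norm :: "real \<Rightarrow> real \<Rightarrow> (real \<Rightarrow> real) \<Rightarrow> real" where
  "sup_norm a b x = (SUP t\<in>{a..b}. \<bar>x t\<bar>)"

text \<open>Below, all bases of \<open>powr\<close> are nonnegative and all exponents positive under the standing
  assumptions (\<open>0 < \<beta>\<close>, \<open>1 < \<alpha> + \<beta>\<close>, \<open>\<psi>\<close> increasing), so \<open>0 powr r = 0\<close> is the right value at
  the boundary points.\<close>

definition green :: "real \<Rightarrow> real \<Rightarrow> real \<Rightarrow> real \<Rightarrow> (real \<Rightarrow> real) \<Rightarrow> real \<Rightarrow> real \<Rightarrow> real" where
  "green a b \<alpha> \<beta> \<psi> \<tau> t =
     (let C = 1 / (Gamma (\<alpha> + \<beta>) * (\<psi> b - \<psi> a) powr \<beta>);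
          D = 1 / Gamma (\<alpha> + \<beta>)
      in if \<tau> \<le> t
         then C * (\<psi> t - \<psi> a) powr \<beta> * (\<psi> b - \<psi> \<tau>) powr (\<alpha> + \<beta> - 1)
              - D * (\<psi> t - \<psi> \<tau>) powr (\<alpha> + \<beta> - 1)
         else C * (\<psi> t - \<psi> a) powr \<beta> * (\<psi> b - \<psi> \<tau>) powr (\<alpha> + \<beta> - 1))"

text \<open>Mild solutions of the boundary value problem that composes the left \<open>\<psi>\<close>-Caputo derivatives
  of orders \<open>\<alpha>\<close> (outer) and \<open>\<beta>\<close> (inner), applied to \<open>x\<close>, plus \<open>f(t, x) = 0\<close>, with \<open>x(a) = 0\<close> and
  \<open>x(b) = \<G>(x)\<close>. Mild solutions are by definition the solutions in \<open>C[a,b]\<close> of the equivalent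
  integral equation, so the differential operators themselves do not occur. \<open>\<psi>'\<close> is the
  derivative of \<open>\<psi>\<close>.\<close>

definition mild_solution ::
  "real \<Rightarrow> real \<Rightarrow> real \<Rightarrow> real \<Rightarrow> (real \<Rightarrow> real) \<Rightarrow> (real \<Rightarrow> real) \<Rightarrow> ((real \<Rightarrow> real) \<Rightarrow> real)
   \<Rightarrow> (real \<Rightarrow> real \<Rightarrow> real) \<Rightarrow> (real \<Rightarrow> real) \<Rightarrow> bool" where
  "mild_solution a b \<alpha> \<beta> \<psi> \<psi>' \<G> f x \<longleftrightarrow>
     x \<in> C_space a b \<and>
     (\<forall>t\<in>{a..b}.
        x t = ((\<psi> t - \<psi> a) / (\<psi> b - \<psi> a)) powr \<beta> * \<G> x
              + integral {a..b} (\<lambda>\<tau>. green a b \<alpha> \<beta> \<psi> \<tau> t * \<psi>' \<tau> * f \<tau> (x \<tau>)))"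

text \<open>Eigenvalues: the case \<open>f(t, x) = -\<lambda> x\<close>, with a mild solution not identically zero on
  \<open>[a,b]\<close>.\<close>

definition is_eigenvalue ::
  "real \<Rightarrow> real \<Rightarrow> real \<Rightarrow> real \<Rightarrow> (real \<Rightarrow> real) \<Rightarrow> (real \<Rightarrow> real) \<Rightarrow> ((real \<Rightarrow> real) \<Rightarrow> real)
   \<Rightarrow> real \<Rightarrow> bool" where
  "is_eigenvalue a b \<alpha> \<beta> \<psi> \<psi>' \<G> lam \<longleftrightarrow>
     (\<exists>x. mild_solution a b \<alpha> \<beta> \<psi> \<psi>' \<G> (\<lambda>t u. - lam * u) x \<and> (\<exists>t\<in>{a..b}. x t \<noteq> 0))"

definition G_max :: "real \<Rightarrow> real \<Rightarrow> real \<Rightarrow> real \<Rightarrow> (real \<Rightarrow> real) \<Rightarrow> real" where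
  "G_max a b \<alpha> \<beta> \<psi> =
     1 / Gamma (\<alpha> + \<beta>) * (\<psi> b - \<psi> a) powr (\<alpha> + \<beta> - 1) *
     max (\<beta> powr \<beta> * (\<alpha> + \<beta> - 1) powr (\<alpha> + \<beta> - 1))
         (\<beta> * (\<alpha> + \<beta> - 1) powr ((\<alpha> + \<beta> - 1) / \<beta>)
            / (\<alpha> + 2 * \<beta> - 1) powr ((\<alpha> + 2 * \<beta> - 1) / \<beta>))"

end

theory Submission
  imports Defs
begin

text \<open>
  Bounding the Green function, or even its integral over \<open>[a,b]\<close>, by \<open>G_max\<close> does not work: for small
  \<open>\<beta>\<close> both can exceed the claimed constant. Instead, substitute \<open>u = (\<psi> t - \<psi> a) / (\<psi> b - \<psi> a)\<close>, put
  \<open>\<gamma> = \<alpha> + \<beta> - 1 \<le> \<beta>\<close>, and read the integral equation as the Volterra equation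
  \<open>y(u) = A * u powr \<beta> + \<nu> \<integral>_0^u (u - s) powr \<gamma> * y(s) ds\<close> with \<open>y(1) = \<G>(x)\<close> and \<open>\<nu>\<close> a multiple of \<open>\<lambda>\<close>. We may take
  \<open>A > 0\<close>. If \<open>\<nu> \<ge> 0\<close>, then \<open>y\<close> peaks at \<open>1\<close>, which contradicts \<open>\<kappa> < 1\<close>. If \<open>\<nu> = -m < 0\<close> and \<open>y \<ge> 0\<close>, the
  drop from the peak value \<open>X = y(t)\<close> to \<open>y(1)\<close> is at most \<open>m M X\<close> with \<open>M = \<beta> powr \<beta> * \<gamma> powr \<gamma>\<close>. A first zero \<open>v\<close> of \<open>y\<close>
  is excluded by rescaling \<open>[0,v]\<close> to \<open>[0,1]\<close>: there the drop would be the full height \<open>X\<close>.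
\<close>

subsection \<open>Inequalities between the constants\<close>

text \<open>Tangent lines of \<open>ln\<close> at 1/5 and at 1/2 serve on the two sides of 1/3, the
  point where both resulting quadratic comparisons change sign. The summand 2/5 is a lower bound for
  \<open>- ln (1 - q)\<close> in \<open>peak_inequality\<close>.\<close>

lemma three_times_square_le_ln:
  fixes r :: real
  assumes "0 < r" "r \<le> 1"
  shows "3 * (1 - r)\<^sup>2 \<le> 2 / 5 - ln r"
proof (cases "r \<le> 1 / 3")
  case True
  have "ln (5 * r) \<le> 5 * r - 1"
    using assms by (intro ln_le_minus_one) auto
  moreover have "ln (5 * r) = ln 5 + ln r"
    using assms by (simp add: ln_mult)
  moreover have "ln (5 :: real) \<ge> 8 / 5"
  proof -
    have "exp (1::real) ^ 8 \<le> (2719 / 1000) ^ 8"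
      using e_approx_32 by (intro power_mono) (auto simp: abs_if split: if_splits)
    also have "\<dots> \<le> 5 ^ 5" by (simp add: power_divide)
    finally have "exp (8 / 5 :: real) ^ 5 \<le> 5 ^ 5"
      by (simp flip: exp_of_nat_mult)
    hence "exp (8 / 5 :: real) \<le> 5" by (subst (asm) power_mono_iff) auto
    thus ?thesis by (subst ln_ge_iff) auto
  qed
  moreover have "r * (1 - 3 * r) \<ge> 0" using assms True by simp
  ultimately show ?thesis by (simp add: power2_eq_square algebra_simps)
next
  case False
  have "ln (2 * r) \<le> 2 * r - 1"
    using assms by (intro ln_le_minus_one) auto
  moreover have "ln (2 * r) = ln 2 + ln r"
    using assms by (simp add: ln_mult)
  moreover have "ln (2 :: real) \<ge> 2 / 3"
    using ln2_ge_two_thirds by simp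
  moreover have "0 \<le> 3 * ((r - 1 / 3) * (1 - r))" using assms False by simp
  hence "3 * (1 - r)\<^sup>2 \<le> 2 - 2 * r" by (simp add: power2_eq_square field_simps)
  ultimately show ?thesis by linarith
qed

text \<open>The tangent of \<open>ln\<close> at \<open>x\<close> bounds
  \<open>x * (ln y - ln x)\<close> by \<open>y - x\<close>; what remains is
  \<open>(y - x) * (1 + ln y)\<close>, which is nonpositive.\<close>

lemma mult_ln_antimono:
  fixes x y :: real
  assumes "0 < x" "x \<le> y" "ln y \<le> -1"
  shows "y * ln y \<le> x * ln x"
proof -
  have "ln (y / x) \<le> y / x - 1" using assms by (intro ln_le_minus_one) auto
  hence "x * (ln y - ln x) \<le> y - x" using assms by (simp add: ln_div field_simps)
  moreover have "(y - x) * (1 + ln y) \<le> 0"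
    using assms by (intro mult_nonneg_nonpos) auto
  ultimately show ?thesis by (simp add: algebra_simps)
qed

text \<open>The true minimum is about 0.692, attained at \<open>exp (- 1)\<close>. The number 37/100
  lies just above that point, so the tangent of \<open>ln\<close> at 37/100 gives
  \<open>- (37 / 100) \<le> x * ln x\<close>, and 689/1000 is a rational below
  \<open>exp (- (37 / 100))\<close>.\<close>

lemma powr_self_lower_bound:
  fixes x :: real
  assumes "0 < x"
  shows "689 / 1000 \<le> x powr x"
proof -
  have "(1 - 37 / 100 / real 32) ^ 32 \<le> exp (- (37 / 100) :: real)"
    using exp_ge_one_plus_x_over_n_power_n[of 32 "- (37 / 100)"] by simp
  hence *: "689 / 1000 \<le> exp (- (37 / 100) :: real)" by (simp add: power_divide)
  have "ln (37 / 100 / x) \<le> 37 / 100 / x - 1"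
    using assms by (intro ln_le_minus_one) auto
  moreover have "ln (37 / 100 / x) = ln (37 / 100) - ln x"
    using assms by (intro ln_divide_pos) auto
  moreover have "-1 \<le> ln (37 / 100 :: real)"
  proof (subst ln_ge_iff)
    show "exp (- 1) \<le> (37 / 100 :: real)"
      using e_approx_32 by (simp add: exp_minus field_simps abs_if split: if_splits)
  qed auto
  ultimately have "- ln x \<le> 37 / 100 / x" by simp
  hence "- (37 / 100) \<le> x * ln x" using assms by (simp add: field_simps)
  hence "exp (- (37 / 100)) \<le> x powr x" using assms by (simp add: powr_def)
  with * show ?thesis by linarith
qed

text \<open>The left side equals \<open>2 * exp (- L) * sinh L\<close>, so \<open>exp (- L)\<close>
  on the right would be too small; the factor 9/10 leaves enough room on this range of
  \<open>L\<close>. It serves to bound \<open>1 - M\<close> once \<open>M\<close> is known to be at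
  least \<open>exp (- (2 * L))\<close>.\<close>

lemma one_minus_exp_le:
  fixes L :: real
  assumes "0 \<le> L" "L \<le> 17 / 50"
  shows "1 - exp (- (2 * L)) \<le> 2 * L * exp (- (9 / 10 * L))"
proof -
  define f where "f = (\<lambda>L::real. 2 * L * exp (- (9 / 10 * L)) + exp (- (2 * L)))"
  have "f 0 \<le> f L"
  proof (rule DERIV_nonneg_imp_nondecreasing[where f = f])
    fix x :: real assume x: "0 \<le> x" "x \<le> L"
    let ?D = "2 * exp (- (2 * x)) * ((1 - 9 / 10 * x) * exp (11 / 10 * x) - 1)"
    have e: "exp (- (x * 9 / 10)) = exp (- (x * 2)) * exp (x * 11 / 10)"
      by (simp flip: exp_add)
    have "(f has_real_derivative ?D) (at x)"
      unfolding f_def by (auto intro!: derivative_eq_intros simp: algebra_simps e)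
    moreover have "0 \<le> ?D"
    proof -
      \<comment> \<open>With the quadratic Taylor polynomial in place of \<open>exp\<close>, the
        sign of the derivative reduces to that of a quadratic in \<open>x\<close> which is still
        positive at 17/50.\<close>
      have "1 + 11 / 10 * x + (11 / 10 * x)\<^sup>2 / 2 \<le> exp (11 / 10 * x)"
        using x by (intro exp_lower_Taylor_quadratic) auto
      hence "(1 - 9 / 10 * x) * (1 + 11 / 10 * x + (11 / 10 * x)\<^sup>2 / 2) \<le> (1 - 9 / 10 * x) * exp (11 / 10 * x)"
        using x assms by (intro mult_left_mono) auto
      moreover have "0 \<le> x * (1 / 5 - 77 / 200 * x - 1089 / 2000 * x * x)"
      proof -
        have "x * x \<le> 17 / 50 * (17 / 50)" using x assms by (intro mult_mono) auto
        thus ?thesis using x assms by (intro mult_nonneg_nonneg) auto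
      qed
      moreover have "(1 - 9 / 10 * x) * (1 + 11 / 10 * x + (11 / 10 * x)\<^sup>2 / 2) =
          1 + x * (1 / 5 - 77 / 200 * x - 1089 / 2000 * x * x)"
        by (simp add: power2_eq_square field_simps)
      ultimately have "1 \<le> (1 - 9 / 10 * x) * exp (11 / 10 * x)"
        by linarith
      thus ?thesis by simp
    qed
    ultimately show "\<exists>y. (f has_real_derivative y) (at x) \<and> 0 \<le> y" by blast
  qed (use assms in auto)
  thus ?thesis by (simp add: f_def)
qed

text \<open>The worst case is \<open>\<gamma> = \<beta>\<close> near \<open>1/5\<close>, where the two sides differ by a factor of about 2. For larger
  \<open>\<beta>\<close> it suffices that \<open>x powr x\<close> is at least \<open>exp (- 1 / exp 1)\<close>; for smaller \<open>\<beta>\<close> one compares \<open>\<gamma> powr \<gamma>\<close>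
  with \<open>\<beta> powr \<beta>\<close> and uses that \<open>\<beta> * (ln \<beta>)\<^sup>2\<close> is at most \<open>4 / (exp 1)\<^sup>2\<close>.\<close>

lemma green_constant_inequality:
  fixes \<beta> \<gamma> :: real
  assumes "0 < \<gamma>" "\<gamma> \<le> \<beta>" "\<beta> \<le> 1"
  defines "M \<equiv> \<beta> powr \<beta> * \<gamma> powr \<gamma>"
  assumes q: "(1 + \<gamma>) * M \<le> 1"
  shows "(1 - (1 + \<gamma>) * M)\<^sup>2 \<le> 12 * \<beta> * M powr (2 + \<gamma>) / (2 + \<gamma>)"
proof (cases "11 / 50 \<le> \<beta>")
  case True
  have "(689 / 1000) * (689 / 1000) \<le> M"
    unfolding M_def using assms by (intro mult_mono powr_self_lower_bound) auto
  hence M: "474 / 1000 \<le> M" by simp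
  have "(1 + \<gamma>) * (474 / 1000) \<le> (1 + \<gamma>) * M" using M assms by (intro mult_left_mono) auto
  hence "(1 - (1 + \<gamma>) * M)\<^sup>2 \<le> (1 - (1 + \<gamma>) * (474 / 1000))\<^sup>2"
    using q by (intro power_mono) auto
  \<comment> \<open>The linear minorants \<open>1 - 3 / 4 * \<gamma>\<close> of
    \<open>(474 / 1000) powr \<gamma>\<close> and \<open>1 / 2 * (1 - \<gamma> / 2)\<close> of
    \<open>1 / (2 + \<gamma>)\<close> leave a comparison of two quadratics in \<gamma>. At \<gamma>
    = 0 it requires \<beta> slightly above 1/5, which the threshold 11/50 meets.\<close>
  also have "\<dots> \<le> 12 * (11 / 50) * ((474 / 1000)\<^sup>2 * (1 - 3 / 4 * \<gamma>)) * (1 / 2 * (1 - \<gamma> / 2))"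
  proof -
    have *: "\<gamma> * \<gamma> \<le> 1 * \<gamma>" using assms by (intro mult_right_mono) auto
    show ?thesis by (simp add: power2_eq_square field_simps) (use * assms(1) in linarith)
  qed
  also have "\<dots> \<le> 12 * \<beta> * M powr (2 + \<gamma>) * (1 / (2 + \<gamma>))"
  proof (intro mult_mono)
    have "- (3 / 4) \<le> ln (474 / 1000 :: real)"
    proof (subst ln_ge_iff)
      have "2718 / 1000 \<le> exp (1::real)"
        using e_approx_32 by (simp add: abs_if split: if_splits)
      hence "(2718 / 1000) ^ 3 \<le> exp (1::real) ^ 3" by (intro power_mono) auto
      hence "(2718 / 1000) ^ 3 \<le> exp (3::real)" by (simp flip: exp_of_nat_mult)
      hence "(1000 / 474) ^ 4 \<le> exp (3 / 4 :: real) ^ 4"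
        by (simp add: power_divide flip: exp_of_nat_mult)
      hence "1000 / 474 \<le> exp (3 / 4 :: real)" by (subst (asm) power_mono_iff) auto
      thus "exp (- (3 / 4)) \<le> (474 / 1000 :: real)" by (simp add: exp_minus field_simps)
    qed auto
    hence "\<gamma> * (- (3 / 4)) \<le> \<gamma> * ln (474 / 1000)" using assms by (intro mult_left_mono) auto
    hence "1 - 3 / 4 * \<gamma> \<le> 1 + \<gamma> * ln (474 / 1000)" by simp
    also have "\<dots> \<le> (474 / 1000) powr \<gamma>" by (simp add: powr_def exp_ge_add_one_self)
    finally have "(474 / 1000)\<^sup>2 * (1 - 3 / 4 * \<gamma>) \<le> (474 / 1000)\<^sup>2 * (474 / 1000) powr \<gamma>"
      by (intro mult_left_mono) auto
    also have "\<dots> = (474 / 1000) powr (2 + \<gamma>)" by (simp add: powr_add powr_numeral)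
    also have "\<dots> \<le> M powr (2 + \<gamma>)" using M assms by (intro powr_mono2) auto
    finally show "(474 / 1000)\<^sup>2 * (1 - 3 / 4 * \<gamma>) \<le> M powr (2 + \<gamma>)" .
    show "1 / 2 * (1 - \<gamma> / 2) \<le> 1 / (2 + \<gamma>)" using assms by (simp add: field_simps)
  qed (use True assms in auto)
  finally show ?thesis by simp
next
  case False
  hence \<beta>: "\<beta> \<le> 11 / 50" by simp
  define L where "L = - (\<beta> * ln \<beta>)"
  have e: "27 / 10 \<le> exp (1::real)" "exp (1::real) \<le> 2719 / 1000" "2718 / 1000 \<le> exp (1::real)"
    using e_approx_32 by (auto simp: abs_if split: if_splits)
  have "ln \<beta> \<le> -1"
  proof -
    have "11 / 50 \<le> exp (- 1 :: real)" using e by (simp add: exp_minus field_simps)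
    hence "\<beta> \<le> exp (- 1)" using \<beta> by linarith
    hence "ln \<beta> \<le> ln (exp (- 1))" using assms by (subst ln_le_cancel_iff) auto
    thus ?thesis by simp
  qed
  \<comment> \<open>The bound 17/11 is chosen because 11/50 times 17/11 is 17/50, the end of the
    range of \<open>one_minus_exp_le\<close>.\<close>
  have "ln (11 / 50 :: real) \<le> -1" "-(17 / 11) \<le> ln (11 / 50 :: real)"
  proof -
    have "11 / 50 \<le> exp (- 1 :: real)" using e by (simp add: exp_minus field_simps)
    hence "ln (11 / 50 :: real) \<le> ln (exp (- 1))" by (subst ln_le_cancel_iff) auto
    thus "ln (11 / 50 :: real) \<le> -1" by simp
    have "exp (17::real) = exp 1 ^ 17" by (simp flip: exp_of_nat_mult)
    also have "\<dots> \<ge> (27 / 10) ^ 17" using e by (intro power_mono) auto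
    finally have "(50 / 11) ^ 11 \<le> exp (17 / 11 :: real) ^ 11"
      by (simp add: power_divide flip: exp_of_nat_mult)
    hence "50 / 11 \<le> exp (17 / 11 :: real)" by (subst (asm) power_mono_iff) auto
    thus "-(17 / 11) \<le> ln (11 / 50 :: real)"
      by (subst ln_ge_iff) (auto simp: exp_minus field_simps)
  qed
  hence "11 / 50 * ln (11 / 50) \<le> \<beta> * ln \<beta>"
    using assms \<beta> by (intro mult_ln_antimono) auto
  hence L_le: "L \<le> 17 / 50" using \<open>-(17 / 11) \<le> ln (11 / 50)\<close> by (simp add: L_def)
  have L_ge: "0 \<le> L" using assms \<open>ln \<beta> \<le> -1\<close> by (simp add: L_def mult_nonneg_nonpos)
  have "\<beta> * ln \<beta> \<le> \<gamma> * ln \<gamma>"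
    using assms \<open>ln \<beta> \<le> -1\<close> by (intro mult_ln_antimono) auto
  hence M: "exp (- (2 * L)) \<le> M"
    using assms by (simp add: M_def powr_def L_def flip: exp_add)
  have "0 < M" using assms by (simp add: M_def)
  have "M \<le> (1 + \<gamma>) * M" using assms \<open>0 < M\<close> by simp
  hence "(1 - (1 + \<gamma>) * M)\<^sup>2 \<le> (1 - exp (- (2 * L)))\<^sup>2"
    using M q by (intro power_mono) auto
  also have "\<dots> \<le> (2 * L * exp (- (9 / 10 * L)))\<^sup>2"
    using L_ge L_le by (intro power_mono one_minus_exp_le) auto
  also have "\<dots> = 4 * L\<^sup>2 * exp (- (9 / 5 * L))"
    by (simp add: power_mult_distrib flip: exp_of_nat_mult)
  also have "\<dots> \<le> 4 * (\<beta> * (2 / (2718 / 1000))\<^sup>2) * exp (- (9 / 5 * L))"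
  proof -
    \<comment> \<open>The tangent bound at this argument is sharp for
      \<open>\<beta> = exp (- 2)\<close>, where \<open>\<beta> * (ln \<beta>)\<^sup>2\<close> has
      its maximum on (0,1).\<close>
    have "ln (1 / (exp 1 * sqrt \<beta>)) \<le> 1 / (exp 1 * sqrt \<beta>) - 1"
      using assms by (intro ln_le_minus_one) auto
    moreover have "ln (1 / (exp 1 * sqrt \<beta>)) = - 1 - ln \<beta> / 2"
      using assms by (simp add: ln_div ln_mult ln_sqrt)
    ultimately have "- ln \<beta> \<le> 2 / (exp 1 * sqrt \<beta>)" by simp
    also have "\<dots> \<le> 2 / (2718 / 1000 * sqrt \<beta>)"
      using assms e by (intro divide_left_mono mult_right_mono mult_pos_pos) auto
    finally have "\<beta> * (- ln \<beta>) \<le> \<beta> * (2 / (2718 / 1000 * sqrt \<beta>))"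
      using assms by (intro mult_left_mono) auto
    also have "\<dots> = sqrt \<beta> * (2 / (2718 / 1000))"
      using assms by (simp add: field_simps)
    finally have "L \<le> sqrt \<beta> * (2 / (2718 / 1000))" by (simp add: L_def)
    hence "L\<^sup>2 \<le> (sqrt \<beta> * (2 / (2718 / 1000)))\<^sup>2" using L_ge by (intro power_mono) auto
    hence "L\<^sup>2 \<le> \<beta> * (2 / (2718 / 1000))\<^sup>2"
      using assms(1,2) by (simp only: power_mult_distrib real_sqrt_pow2)
    thus ?thesis by (intro mult_right_mono mult_left_mono) auto
  qed
  \<comment> \<open>Here 111/50 = 2 + 11/50 bounds \<open>2 + \<gamma>\<close>, and 111/25 is twice
    that. The exponents differ by 66/25 times \<open>L\<close>, at most 9/10 because
    \<open>L \<le> 17 / 50\<close>; the factor lost is thus at most 62/25.\<close>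
  also have "\<dots> \<le> 12 * \<beta> / (111 / 50) * exp (- (111 / 25 * L))"
  proof -
    have "exp (9 / 10 :: real) ^ 10 = exp 1 ^ 9" by (simp flip: exp_of_nat_mult)
    also have "\<dots> \<le> (2719 / 1000) ^ 9" using e by (intro power_mono) auto
    also have "\<dots> \<le> (62 / 25) ^ 10" by (simp add: power_divide)
    finally have "exp (9 / 10 :: real) \<le> 62 / 25" by (subst (asm) power_mono_iff) auto
    moreover have "exp (66 / 25 * L) \<le> exp (9 / 10)" using L_le by simp
    ultimately have "exp (66 / 25 * L) \<le> 62 / 25" by linarith
    moreover have "exp (- (9 / 5 * L)) = exp (66 / 25 * L) * exp (- (111 / 25 * L))"
      by (simp flip: exp_add)
    ultimately have *: "exp (- (9 / 5 * L)) \<le> 62 / 25 * exp (- (111 / 25 * L))" by simp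
    have "4 * (\<beta> * (2 / (2718 / 1000))\<^sup>2) * exp (- (9 / 5 * L)) \<le>
          4 * (\<beta> * (2 / (2718 / 1000))\<^sup>2) * (62 / 25 * exp (- (111 / 25 * L)))"
      using assms * by (intro mult_left_mono) auto
    also have "\<dots> = (4 * (2 / (2718 / 1000))\<^sup>2 * (62 / 25)) * (\<beta> * exp (- (111 / 25 * L)))"
      by simp
    also have "\<dots> \<le> (12 / (111 / 50)) * (\<beta> * exp (- (111 / 25 * L)))"
      using assms by (intro mult_right_mono) (auto simp: power_divide)
    finally show ?thesis by simp
  qed
  also have "\<dots> \<le> 12 * \<beta> / (2 + \<gamma>) * M powr (2 + \<gamma>)"
  proof (intro mult_mono divide_left_mono)
    have "- (111 / 25 * L) \<le> (2 + \<gamma>) * (- (2 * L))"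
    proof -
      have "(2 + \<gamma>) * (2 * L) \<le> 111 / 50 * (2 * L)"
        using assms \<beta> L_ge by (intro mult_right_mono) auto
      thus ?thesis by simp
    qed
    also have "\<dots> \<le> (2 + \<gamma>) * ln M"
      using M \<open>0 < M\<close> assms by (intro mult_left_mono) (auto simp: ln_ge_iff)
    finally show "exp (- (111 / 25 * L)) \<le> M powr (2 + \<gamma>)"
      using \<open>0 < M\<close> by (simp add: powr_def)
  qed (use assms \<beta> in auto)
  finally show ?thesis by (simp add: field_simps)
qed

text \<open>Writing \<open>d\<close> for the excess of the left factor over \<open>M\<close>, this is \<open>m * d \<le> T + m\<^sup>2 * c\<close>, which holds
  for all \<open>m\<close> as soon as \<open>d\<^sup>2 \<le> 4 * T * c\<close> (AM-GM).\<close>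

lemma peak_inequality:
  fixes \<beta> \<gamma> m t :: real
  assumes "0 < \<gamma>" "\<gamma> \<le> \<beta>" "\<beta> \<le> 1" "0 \<le> m" "0 < t" "t \<le> 1"
  defines "M \<equiv> \<beta> powr \<beta> * \<gamma> powr \<gamma>"
  shows "m * ((1 - t powr (1 + \<gamma>)) / (1 + \<gamma>)) \<le>
         m * M + (t powr - \<beta> - 1) + m\<^sup>2 * (M powr (2 + \<gamma>) / ((1 + \<gamma>) * (2 + \<gamma>)))"
proof -
  define q where "q = (1 + \<gamma>) * M"
  define \<tau> where "\<tau> = t powr (1 + \<gamma>)"
  define c where "c = M powr (2 + \<gamma>) / ((1 + \<gamma>) * (2 + \<gamma>))"
  define T where "T = - (\<beta> / (1 + \<gamma>) * ln \<tau>)"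
  have "(689 / 1000) * (689 / 1000) \<le> M"
    unfolding M_def using assms(1-3) by (intro mult_mono powr_self_lower_bound) auto
  hence M: "4 / 10 \<le> M" by simp
  have \<tau>: "0 < \<tau>" "\<tau> \<le> 1" using assms(1-6) by (auto simp: \<tau>_def powr_le1)
  have c: "0 \<le> c" using assms(1) by (simp add: c_def)
  have T: "T \<le> t powr - \<beta> - 1"
  proof -
    have "1 + (- \<beta>) * ln t \<le> t powr - \<beta>"
      using assms(5) exp_ge_add_one_self[of "(- \<beta>) * ln t"] by (simp add: powr_def)
    moreover have "T = (- \<beta>) * ln t"
      using assms(1,5) by (simp add: T_def \<tau>_def ln_powr)
    ultimately show ?thesis by simp
  qed
  have "0 \<le> T"
    using assms(1,2) \<tau> unfolding T_def neg_0_le_iff_le by (intro mult_nonneg_nonpos) auto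
  define d where "d = (1 - q - \<tau>) / (1 + \<gamma>)"
  have "m * d \<le> T + m\<^sup>2 * c"
  proof (cases "1 - q - \<tau> \<le> 0")
    case True
    hence "m * d \<le> 0"
      using assms(1,4) by (simp add: d_def divide_nonpos_pos mult_nonneg_nonpos)
    moreover have "0 \<le> T + m\<^sup>2 * c" using \<open>0 \<le> T\<close> c by simp
    ultimately show ?thesis by linarith
  next
    case False
    \<comment> \<open>Now \<open>1 - q - \<tau>\<close> factors as \<open>(1 - q) * (1 - r)\<close>,
      and \<open>- ln \<tau>\<close> splits into \<open>- ln r\<close> and
      \<open>- ln (1 - q)\<close>, the latter at least 2/5 since \<open>q\<close> is. The two
      factors are then controlled by \<open>green_constant_inequality\<close> and
      \<open>three_times_square_le_ln\<close>.\<close>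
    define r where "r = \<tau> / (1 - q)"
    have "M \<le> q" using M assms(1) by (simp add: q_def)
    have r: "0 < r" "r \<le> 1" "0 < 1 - q" using False \<tau> by (auto simp: r_def field_simps)
    have "ln (1 - q) \<le> - (2 / 5)"
    proof -
      have "ln (1 - q) \<le> (1 - q) - 1" using r by (intro ln_le_minus_one) auto
      thus ?thesis using M \<open>M \<le> q\<close> by linarith
    qed
    moreover have "ln r = ln \<tau> - ln (1 - q)"
      using \<tau> r by (simp add: r_def ln_divide_pos)
    ultimately have "3 * (1 - r)\<^sup>2 \<le> - ln \<tau>"
      using three_times_square_le_ln[OF r(1,2)] by linarith
    hence "3 * (1 - r)\<^sup>2 * (1 - q)\<^sup>2 \<le> - ln \<tau> * (1 - q)\<^sup>2"
      by (rule mult_right_mono) auto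
    also have "\<dots> \<le> - ln \<tau> * (12 * \<beta> * M powr (2 + \<gamma>) / (2 + \<gamma>))"
      using green_constant_inequality[OF assms(1-3)] r \<tau> unfolding q_def M_def
      by (intro mult_left_mono) auto
    also have "3 * (1 - r)\<^sup>2 * (1 - q)\<^sup>2 = 3 * ((1 - r) * (1 - q))\<^sup>2"
      by (simp add: power_mult_distrib)
    also have "(1 - r) * (1 - q) = 1 - q - \<tau>" using r by (simp add: r_def field_simps)
    also have "1 - q - \<tau> = (1 + \<gamma>) * d" using assms(1) by (simp add: d_def)
    also have "- ln \<tau> * (12 * \<beta> * M powr (2 + \<gamma>) / (2 + \<gamma>)) = 12 * (1 + \<gamma>)\<^sup>2 * (T * c)"
      using assms(1) by (simp add: T_def c_def power2_eq_square)
    finally have "(1 + \<gamma>)\<^sup>2 * d\<^sup>2 \<le> (1 + \<gamma>)\<^sup>2 * (4 * T * c)"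
      by (simp add: power_mult_distrib mult_ac)
    hence "d\<^sup>2 \<le> 4 * T * c" using assms(1) by simp
    hence "m\<^sup>2 * d\<^sup>2 \<le> m\<^sup>2 * (4 * T * c)" by (intro mult_left_mono) auto
    also have "\<dots> \<le> (T + m\<^sup>2 * c)\<^sup>2"
      using zero_le_power2[of "T - m\<^sup>2 * c"] by (simp add: power2_eq_square algebra_simps)
    finally have "(m * d)\<^sup>2 \<le> (T + m\<^sup>2 * c)\<^sup>2" by (simp add: power_mult_distrib)
    moreover have "0 \<le> T + m\<^sup>2 * c" using \<open>0 \<le> T\<close> c by simp
    ultimately show ?thesis by (rule power2_le_imp_le)
  qed
  moreover have "(1 - \<tau>) / (1 + \<gamma>) = M + d"
  proof -
    have "M = q / (1 + \<gamma>)" using assms(1) by (simp add: q_def)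
    thus ?thesis by (simp add: d_def flip: add_divide_distrib)
  qed
  ultimately show ?thesis using T by (simp add: \<tau>_def c_def algebra_simps)
qed

subsection \<open>The Riemann-Liouville kernel\<close>

text \<open>Clipping at 0 makes the kernel vanish for \<open>u \<le> s\<close>, so Volterra
  integrals up to \<open>u\<close> can be taken over the fixed interval [0,1]. For \<gamma> > 0 the
  kernel is continuous. Up to a Gamma factor it is the kernel of the fractional integral of order 1
  + \<gamma>.\<close>

definition riesz_kernel :: "real \<Rightarrow> real \<Rightarrow> real \<Rightarrow> real" where
  "riesz_kernel \<gamma> u s = max 0 (u - s) powr \<gamma>"

lemma riesz_kernel_nonneg [simp]: "0 \<le> riesz_kernel \<gamma> u s"
  by (simp add: riesz_kernel_def)

lemma riesz_kernel_mono: "0 \<le> \<gamma> \<Longrightarrow> u \<le> v \<Longrightarrow> riesz_kernel \<gamma> u s \<le> riesz_kernel \<gamma> v s"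
  unfolding riesz_kernel_def by (intro powr_mono2) auto

lemma riesz_kernel_le_1: "0 \<le> \<gamma> \<Longrightarrow> u \<le> 1 \<Longrightarrow> 0 \<le> s \<Longrightarrow> riesz_kernel \<gamma> u s \<le> 1"
  unfolding riesz_kernel_def by (intro powr_le1) auto

lemma riesz_kernel_eq_0: "u \<le> s \<Longrightarrow> riesz_kernel \<gamma> u s = 0"
  by (simp add: riesz_kernel_def)

lemma continuous_on_riesz_kernel [continuous_intros]:
  assumes "0 < \<gamma>" "continuous_on S f" "continuous_on S g"
  shows "continuous_on S (\<lambda>s. riesz_kernel \<gamma> (f s) (g s))"
  unfolding riesz_kernel_def using assms by (intro continuous_on_powr' continuous_intros) auto

lemma has_real_derivative_powr_reflect:
  fixes p u s :: real
  assumes "0 < p" "s < u"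
  shows "((\<lambda>s. (u - s) powr p / p) has_real_derivative - ((u - s) powr (p - 1))) (at s)"
proof -
  have "((\<lambda>s. (u - s) powr p) has_real_derivative (p * (u - s) powr (p - 1)) * (-1)) (at s)"
    by (rule DERIV_chain2[OF has_real_derivative_powr]) (use assms in \<open>auto intro!: derivative_eq_intros\<close>)
  from DERIV_cdivide[OF this, of p] show ?thesis using assms by simp
qed

lemma has_integral_riesz_kernel:
  fixes u :: real
  assumes "0 < \<gamma>" "0 \<le> u" "u \<le> 1"
  shows "(riesz_kernel \<gamma> u has_integral u powr (1 + \<gamma>) / (1 + \<gamma>)) {0..1}"
proof -
  define F where "F = (\<lambda>s. - (max 0 (u - s) powr (1 + \<gamma>) / (1 + \<gamma>)))"
  have "(riesz_kernel \<gamma> u has_integral F 1 - F 0) {0..1}"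
  \<comment> \<open>The point \<open>u\<close>, where the two branches of \<open>max\<close> meet,
    goes into the exceptional set.\<close>
  proof (rule fundamental_theorem_of_calculus_interior_strong[where S = "{u}"])
    fix s assume s: "s \<in> {0<..<1} - {u}"
    have "(F has_real_derivative riesz_kernel \<gamma> u s) (at s)"
    proof (cases "s < u")
      case True
      have "((\<lambda>s. - ((u - s) powr (1 + \<gamma>) / (1 + \<gamma>))) has_real_derivative (u - s) powr \<gamma>) (at s)"
        using DERIV_minus[OF has_real_derivative_powr_reflect[of "1 + \<gamma>" s u]] True assms by simp
      moreover have "\<forall>\<^sub>F y in nhds s. - ((u - y) powr (1 + \<gamma>) / (1 + \<gamma>)) = F y"
        by (rule eventually_mono[OF eventually_nhds_in_open[of "{..<u}"]]) (use True in \<open>auto simp: F_def max_def\<close>)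
      moreover have "(u - s) powr \<gamma> = riesz_kernel \<gamma> u s"
        using True by (simp add: riesz_kernel_def max_def)
      ultimately show ?thesis by (metis DERIV_cong_ev)
    next
      case False
      hence "u < s" using s by auto
      have "\<forall>\<^sub>F y in nhds s. 0 = F y"
        by (rule eventually_mono[OF eventually_nhds_in_open[of "{u<..}"]]) (use \<open>u < s\<close> in \<open>auto simp: F_def max_def\<close>)
      from DERIV_cong_ev[OF refl this refl, of 0] have "(F has_real_derivative 0) (at s)" by simp
      thus ?thesis using \<open>u < s\<close> by (simp add: riesz_kernel_eq_0)
    qed
    thus "(F has_vector_derivative riesz_kernel \<gamma> u s) (at s)"
      by (simp add: has_real_derivative_iff_has_vector_derivative)
  next
    show "continuous_on {0..1} F"
      unfolding F_def using assms by (intro continuous_intros continuous_on_powr') auto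
  qed auto
  thus ?thesis using assms by (simp add: F_def)
qed

text \<open>This computes the second-order gain in \<open>positive_solution_peak_drop\<close>. Only
  [1 - M, 1] contributes, and there \<open>M\<close> and \<open>1 - s\<close> are integrated
  separately against the kernel.\<close>

lemma has_integral_clipped_riesz_kernel:
  fixes M :: real
  assumes "0 < \<gamma>" "0 \<le> M" "M \<le> 1"
  shows "((\<lambda>s. riesz_kernel \<gamma> 1 s * max 0 (M - (1 - s))) has_integral
           M powr (2 + \<gamma>) / ((1 + \<gamma>) * (2 + \<gamma>))) {0..1}"
proof -
  define F where "F = (\<lambda>s. (1 - s) powr (2 + \<gamma>) / (2 + \<gamma>) - M * ((1 - s) powr (1 + \<gamma>) / (1 + \<gamma>)))"
  define f where "f = (\<lambda>s. riesz_kernel \<gamma> 1 s * max 0 (M - (1 - s)))"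
  have "(f has_integral F 1 - F (1 - M)) {1 - M..1}"
  proof (rule fundamental_theorem_of_calculus_interior)
    fix s assume s: "s \<in> {1 - M<..<1}"
    have "(F has_real_derivative (1 - s) powr \<gamma> * (M - (1 - s))) (at s)"
    proof -
      have deriv: "(F has_real_derivative - ((1 - s) powr (2 + \<gamma> - 1)) - M * - ((1 - s) powr (1 + \<gamma> - 1))) (at s)"
        unfolding F_def using s assms
        by (intro DERIV_diff DERIV_cmult has_real_derivative_powr_reflect) auto
      have split: "(1 - s) powr (2 + \<gamma> - 1) = (1 - s) * (1 - s) powr \<gamma>"
        using s assms by (simp add: powr_mult_base add.commute)
      show ?thesis
        by (rule DERIV_cong[OF deriv], unfold split) (simp add: algebra_simps)
    qed
    moreover have "f s = (1 - s) powr \<gamma> * (M - (1 - s))"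
      using s by (simp add: f_def riesz_kernel_def max_def)
    ultimately show "(F has_vector_derivative f s) (at s)"
      by (simp add: has_real_derivative_iff_has_vector_derivative)
  next
    show "continuous_on {1 - M..1} F"
      unfolding F_def using assms by (intro continuous_intros continuous_on_powr') auto
  qed (use assms in auto)
  moreover have "(f has_integral 0) {0..1 - M}"
    by (rule has_integral_eq[where f = "\<lambda>_. 0"]) (auto simp: f_def max_def)
  ultimately have "(f has_integral 0 + (F 1 - F (1 - M))) {0..1}"
    using assms by (intro has_integral_combine[of 0 "1 - M" 1]) auto
  moreover have "0 + (F 1 - F (1 - M)) = M powr (2 + \<gamma>) / ((1 + \<gamma>) * (2 + \<gamma>))"
  proof -
    have "M * M powr (1 + \<gamma>) = M powr (2 + \<gamma>)"
      using assms by (cases "M = 0") (auto simp: powr_add powr_numeral power2_eq_square)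
    hence "0 + (F 1 - F (1 - M)) = M powr (2 + \<gamma>) / (1 + \<gamma>) - M powr (2 + \<gamma>) / (2 + \<gamma>)"
      by (simp add: F_def)
    also have "\<dots> = M powr (2 + \<gamma>) / ((1 + \<gamma>) * (2 + \<gamma>))"
      using assms by (simp add: field_simps)
    finally show ?thesis .
  qed
  ultimately show ?thesis by (simp add: f_def)
qed

lemma integrable_riesz_kernel_mult:
  assumes "0 < \<gamma>" "continuous_on {a..b} x"
  shows "(\<lambda>s. riesz_kernel \<gamma> u s * x s) integrable_on {a..b}"
  using assms by (intro integrable_continuous_interval continuous_intros) auto

lemma riesz_integral_0: "integral {0..1} (\<lambda>s. riesz_kernel \<gamma> 0 s * x s) = 0"
  using integral_cong[of "{0..1}" "\<lambda>s. riesz_kernel \<gamma> 0 s * x s" "\<lambda>_. 0"]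
  by (simp add: riesz_kernel_eq_0)

text \<open>The left side is the integral of \<open>s powr \<gamma>\<close> over [u,1], where the
  integrand is at most 1; rearranged, this is Bernoulli's inequality. It makes the drop to the right
  endpoint linear in the distance from it.\<close>

lemma one_minus_powr_le:
  fixes \<gamma> u :: real
  assumes "0 < \<gamma>" "0 \<le> u" "u \<le> 1"
  shows "(1 - u powr (1 + \<gamma>)) / (1 + \<gamma>) \<le> 1 - u"
proof (cases "u = 0")
  case False
  hence "0 < u" using assms by simp
  have "ln (1 / u) \<le> 1 / u - 1" using \<open>0 < u\<close> by (intro ln_le_minus_one) auto
  hence "\<gamma> * (1 - 1 / u) \<le> \<gamma> * ln u"
    using assms \<open>0 < u\<close> by (intro mult_left_mono) (auto simp: ln_divide_pos)
  hence "1 + \<gamma> * (1 - 1 / u) \<le> 1 + \<gamma> * ln u" by linarith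
  also have "\<dots> \<le> u powr \<gamma>" using \<open>0 < u\<close> by (simp add: powr_def)
  finally have "u * (1 + \<gamma> * (1 - 1 / u)) \<le> u * u powr \<gamma>" using \<open>0 < u\<close> by (intro mult_left_mono) auto
  hence "u + \<gamma> * u - \<gamma> \<le> u powr (1 + \<gamma>)"
    using \<open>0 < u\<close> by (simp add: powr_mult_base algebra_simps)
  thus ?thesis using assms by (simp add: field_simps)
qed (use assms in auto)

subsection \<open>The Volterra equation on the unit interval\<close>

text \<open>Bounding \<open>x\<close> by its peak in the integral gives a drop of \<open>m * \<phi> t\<close> minus the decay of the source term,
  both relative to the peak; for small \<open>\<beta>\<close> this is not yet below \<open>m * M\<close>. If the claim fails, then the same bound started
  from \<open>s\<close> instead of \<open>t\<close> shows that \<open>x\<close> stays well below its peak on \<open>[1 - M, 1]\<close>, and feeding this back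
  gains the term quadratic in \<open>m\<close> that \<open>peak_inequality\<close> needs.\<close>

lemma positive_solution_peak_drop:
  fixes A m t \<beta> \<gamma> :: real
  assumes "0 < \<gamma>" "\<gamma> \<le> \<beta>" "\<beta> \<le> 1" "0 \<le> A" "0 \<le> m"
    and cont: "continuous_on {0..1} x"
    and nonneg: "\<And>u. u \<in> {0..1} \<Longrightarrow> 0 \<le> x u"
    and eq: "\<And>u. u \<in> {0..1} \<Longrightarrow>
      x u = A * u powr \<beta> - m * integral {0..1} (\<lambda>s. riesz_kernel \<gamma> u s * x s)"
    and t: "t \<in> {0..1}" and peak: "\<And>u. u \<in> {0..1} \<Longrightarrow> x u \<le> x t"
  shows "x t - x 1 \<le> m * (\<beta> powr \<beta> * \<gamma> powr \<gamma>) * x t"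
proof (rule ccontr)
  define M where "M = \<beta> powr \<beta> * \<gamma> powr \<gamma>"
  define J where "J = (\<lambda>u. integral {0..1} (\<lambda>s. riesz_kernel \<gamma> u s * x s))"
  define \<phi> where "\<phi> = (\<lambda>u::real. (1 - u powr (1 + \<gamma>)) / (1 + \<gamma>))"
  assume "\<not> x t - x 1 \<le> m * (\<beta> powr \<beta> * \<gamma> powr \<gamma>) * x t"
  hence contra: "m * M * x t < x t - x 1" by (simp add: M_def)
  have M: "0 \<le> M" "M \<le> 1"
    using assms(1-3) by (auto simp: M_def intro!: mult_le_one powr_le1)
  note int = integrable_riesz_kernel_mult[OF assms(1) cont]
  have "0 \<le> x t" using nonneg t by blast
  have "x t \<noteq> 0"
    using contra nonneg[of 1] by auto
  hence X: "0 < x t" using \<open>0 \<le> x t\<close> by simp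
  have "t \<noteq> 0"
    using eq[of 0] X riesz_integral_0[of \<gamma> x] by auto
  hence "0 < t" "t \<le> 1" using t by auto
  have J_nonneg: "0 \<le> J u" for u
    unfolding J_def using nonneg by (intro integral_nonneg int) auto
  have kernel: "((\<lambda>s. riesz_kernel \<gamma> 1 s - riesz_kernel \<gamma> u s) has_integral \<phi> u) {0..1}"
    if "u \<in> {0..1}" for u
    using has_integral_diff[OF has_integral_riesz_kernel[of \<gamma> 1] has_integral_riesz_kernel[of \<gamma> u]]
      assms(1) that by (simp add: \<phi>_def diff_divide_distrib)
  have J_diff: "((\<lambda>s. (riesz_kernel \<gamma> 1 s - riesz_kernel \<gamma> u s) * x s) has_integral J 1 - J u) {0..1}" for u
    using has_integral_diff[OF int[of 1, THEN integrable_integral] int[of u, THEN integrable_integral]]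
    by (simp add: J_def algebra_simps)
  have x_eq: "x u - x 1 = - (A * (1 - u powr \<beta>)) + m * (J 1 - J u)" if "u \<in> {0..1}" for u
    using eq[OF that] eq[of 1] by (simp add: J_def algebra_simps)
  have drop: "x u - x 1 \<le> m * x t * (1 - u)" if u: "u \<in> {0..1}" for u
  proof -
    have "J 1 - J u \<le> \<phi> u * x t"
    proof (rule has_integral_le[OF J_diff has_integral_mult_left[OF kernel[OF u]]])
      fix s :: real assume "s \<in> {0..1}"
      thus "(riesz_kernel \<gamma> 1 s - riesz_kernel \<gamma> u s) * x s \<le> (riesz_kernel \<gamma> 1 s - riesz_kernel \<gamma> u s) * x t"
        using riesz_kernel_mono[of \<gamma> u 1 s] assms(1) u by (intro mult_left_mono peak) auto
    qed
    also have "\<dots> \<le> (1 - u) * x t"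
      unfolding \<phi>_def using one_minus_powr_le[of \<gamma> u] assms(1) u X by (intro mult_right_mono) auto
    finally have "m * (J 1 - J u) \<le> m * ((1 - u) * x t)" using assms(5) by (rule mult_left_mono)
    moreover have "0 \<le> A * (1 - u powr \<beta>)"
      using assms(1,2,4) u by (intro mult_nonneg_nonneg) (auto intro: powr_le1)
    ultimately show ?thesis using x_eq[OF u] by (simp add: algebra_simps)
  qed
  show False
  proof (cases "1 - M \<le> t")
    case True
    \<comment> \<open>A peak this close to 1 is settled by the linear bound \<open>drop\<close>
      alone.\<close>
    have "m * x t * (1 - t) \<le> m * x t * M" using True assms(5) X by (intro mult_left_mono) auto
    thus False using drop[OF t] contra by (simp add: algebra_simps)
  next
    case False
    define c where "c = M powr (2 + \<gamma>) / ((1 + \<gamma>) * (2 + \<gamma>))"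
    have "J 1 - J t \<le> \<phi> t * x t - (m * x t) * c"
      unfolding c_def
    proof (rule has_integral_le[OF J_diff has_integral_diff[OF has_integral_mult_left[OF kernel[OF t]]
        has_integral_mult_right[OF has_integral_clipped_riesz_kernel]]])
      fix s :: real assume s: "s \<in> {0..1}"
      have mono: "0 \<le> riesz_kernel \<gamma> 1 s - riesz_kernel \<gamma> t s"
        using riesz_kernel_mono[of \<gamma> t 1 s] assms(1) t by auto
      show "(riesz_kernel \<gamma> 1 s - riesz_kernel \<gamma> t s) * x s \<le>
        (riesz_kernel \<gamma> 1 s - riesz_kernel \<gamma> t s) * x t - m * x t * (riesz_kernel \<gamma> 1 s * max 0 (M - (1 - s)))"
      proof (cases "s \<le> 1 - M")
        case True
        hence "max 0 (M - (1 - s)) = 0" by simp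
        thus ?thesis using mult_left_mono[OF peak[OF s] mono] by simp
      next
        case below: False
        \<comment> \<open>The negated claim puts \<open>x 1\<close> below
          \<open>x t - m * M * x t\<close>, and \<open>drop\<close> at \<open>s\<close> adds at most
          \<open>m * x t * (1 - s)\<close>. Since \<open>t < 1 - M < s\<close>, the kernel at
          \<open>t\<close> vanishes here, so only the kernel at 1 remains.\<close>
        have "x s \<le> x t - m * x t * (M - (1 - s))"
          using drop[OF s] contra by (simp add: algebra_simps)
        hence "riesz_kernel \<gamma> 1 s * x s \<le> riesz_kernel \<gamma> 1 s * (x t - m * x t * (M - (1 - s)))"
          by (intro mult_left_mono) auto
        thus ?thesis using below False by (simp add: riesz_kernel_eq_0 max_def algebra_simps)
      qed
    qed (use assms(1) M in auto)
    hence "m * (J 1 - J t) \<le> m * (\<phi> t * x t - (m * x t) * c)" using assms(5) by (rule mult_left_mono)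
    \<comment> \<open>The integral is nonnegative, so the source term alone is at least the peak:
      \<open>x t \<le> A * t powr \<beta>\<close>. This turns the growth of the source from
      \<open>t\<close> to 1 into a multiple of \<open>x t\<close>.\<close>
    moreover have "(t powr - \<beta> - 1) * x t \<le> A * (1 - t powr \<beta>)"
    proof -
      have "x t \<le> A * t powr \<beta>"
        using eq[OF t] J_nonneg[of t] assms(5) by (simp add: J_def)
      hence "(t powr - \<beta> * (1 - t powr \<beta>)) * x t \<le> (t powr - \<beta> * (1 - t powr \<beta>)) * (A * t powr \<beta>)"
        using \<open>0 < t\<close> \<open>t \<le> 1\<close> assms(1,2) by (intro mult_left_mono mult_nonneg_nonneg) (auto intro: powr_le1)
      moreover have "t powr - \<beta> * t powr \<beta> = 1" using \<open>0 < t\<close> by (simp flip: powr_add)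
      ultimately show ?thesis by (simp add: algebra_simps)
    qed
    moreover have "m * \<phi> t * x t \<le> (m * M + (t powr - \<beta> - 1) + m\<^sup>2 * c) * x t"
      using peak_inequality[OF assms(1-3,5) \<open>0 < t\<close> \<open>t \<le> 1\<close>] X
      unfolding M_def c_def \<phi>_def by (intro mult_right_mono) auto
    ultimately have "x t - x 1 \<le> m * M * x t"
      using x_eq[OF t] by (simp add: algebra_simps power2_eq_square)
    thus False using contra by simp
  qed
qed

text \<open>The kernel is homogeneous of degree \<gamma> and the substitution contributes one more
  factor \<open>v\<close>. Hence the equation restricted to [0,v] takes the same form on [0,1] with
  a rescaled coefficient.\<close>

lemma riesz_integral_scale:
  fixes v u \<gamma> :: real
  assumes "0 < \<gamma>" "continuous_on {0..1} y" "0 < v" "v \<le> 1" "u \<in> {0..1}"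
  shows "integral {0..1} (\<lambda>s. riesz_kernel \<gamma> (v * u) s * y s) =
         v powr (1 + \<gamma>) * integral {0..1} (\<lambda>s. riesz_kernel \<gamma> u s * y (v * s))"
proof -
  define f where "f = (\<lambda>s. riesz_kernel \<gamma> (v * u) s * y s)"
  have f: "continuous_on {0..1} f"
    unfolding f_def using assms by (intro continuous_intros) auto
  have "((\<lambda>s. v *\<^sub>R f (v * s)) has_integral integral {v * 0..v * 1} f) {0..1}"
    by (rule has_integral_substitution[where c = 0 and d = 1])
       (use assms f in \<open>auto intro!: derivative_eq_intros mult_le_one\<close>)
  moreover have "v *\<^sub>R f (v * s) = v powr (1 + \<gamma>) * (riesz_kernel \<gamma> u s * y (v * s))" for s
  proof -
    have "max 0 (v * u - v * s) = v * max 0 (u - s)"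
      using assms(3) by (simp add: max_def algebra_simps)
    hence "riesz_kernel \<gamma> (v * u) (v * s) = v powr \<gamma> * riesz_kernel \<gamma> u s"
      using assms(3) by (simp add: riesz_kernel_def powr_mult)
    thus ?thesis using assms(3) by (simp add: f_def powr_add)
  qed
  ultimately have "((\<lambda>s. v powr (1 + \<gamma>) * (riesz_kernel \<gamma> u s * y (v * s))) has_integral integral {0..v} f) {0..1}"
    by simp
  from integral_unique[OF this]
  have "integral {0..v} f = v powr (1 + \<gamma>) * integral {0..1} (\<lambda>s. riesz_kernel \<gamma> u s * y (v * s))"
    by simp
  moreover have "integral {v..1} f = 0"
  proof -
    have "v * u \<le> s" if "v \<le> s" for s
    proof -
      have "v * u \<le> v * 1" using assms by (intro mult_left_mono) auto
      thus ?thesis using that by simp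
    qed
    hence "integral {v..1} f = integral {v..1} (\<lambda>_. 0)"
      by (intro integral_cong) (auto simp: f_def riesz_kernel_eq_0)
    thus ?thesis by simp
  qed
  moreover have "integral {0..v} f + integral {v..1} f = integral {0..1} f"
    using assms f by (intro Henstock_Kurzweil_Integration.integral_combine integrable_continuous_interval) auto
  ultimately show ?thesis by (simp add: f_def)
qed

section \<open>Uniqueness and positivity for the Volterra equation\<close>

lemma riesz_equation_zero:
  fixes \<nu> \<gamma> :: real
  assumes "0 < \<gamma>" "continuous_on {0..1} y"
    and eq: "\<And>u. u \<in> {0..1} \<Longrightarrow> y u = \<nu> * integral {0..1} (\<lambda>s. riesz_kernel \<gamma> u s * y s)"
    and "u \<in> {0..1}"
  shows "y u = 0"
proof -
  \<comment> \<open>The integral operator is a contraction in the norm weighted by \<open>exp (- N * u)\<close>.\<close>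
  define N where "N = \<bar>\<nu>\<bar> + 1"
  have "0 < N" "\<bar>\<nu>\<bar> < N" by (auto simp: N_def)
  define z where "z = (\<lambda>u. \<bar>y u\<bar> * exp (- (N * u)))"
  have "continuous_on {0..1} z" unfolding z_def using assms by (intro continuous_intros)
  then obtain t where t: "t \<in> {0..1}" and max: "\<And>u. u \<in> {0..1} \<Longrightarrow> z u \<le> z t"
    using continuous_attains_sup[of "{0..1}" z] by auto
  have y_le: "\<bar>y s\<bar> \<le> z t * exp (N * s)" if "s \<in> {0..1}" for s
  proof -
    have "\<bar>y s\<bar> = z s * exp (N * s)" by (simp add: z_def flip: exp_add)
    thus ?thesis using max[OF that] by simp
  qed
  define f where "f = (\<lambda>s. riesz_kernel \<gamma> t s * y s)"
  have f: "continuous_on {0..1} f" unfolding f_def using assms by (intro continuous_intros) auto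
  have "integral {0..t} f + integral {t..1} f = integral {0..1} f"
    using t f by (intro Henstock_Kurzweil_Integration.integral_combine integrable_continuous_interval) auto
  moreover have "integral {t..1} f = integral {t..1} (\<lambda>_. 0)"
    by (intro integral_cong) (auto simp: f_def riesz_kernel_eq_0)
  ultimately have "integral {0..1} f = integral {0..t} f" by simp
  moreover have "norm (integral {0..t} f) \<le> integral {0..t} (\<lambda>s. z t * exp (N * s))"
  proof (rule integral_norm_bound_integral)
    show "f integrable_on {0..t}"
      using t by (intro integrable_continuous_interval continuous_on_subset[OF f]) auto
    show "(\<lambda>s. z t * exp (N * s)) integrable_on {0..t}"
      by (intro integrable_continuous_interval continuous_intros)
    fix s assume "s \<in> {0..t}"
    hence s: "s \<in> {0..1}" using t by auto
    have "norm (f s) = riesz_kernel \<gamma> t s * \<bar>y s\<bar>" by (simp add: f_def abs_mult)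
    also have "\<dots> \<le> 1 * (z t * exp (N * s))"
      using assms(1) s t by (intro mult_mono riesz_kernel_le_1 y_le) auto
    finally show "norm (f s) \<le> z t * exp (N * s)" by simp
  qed
  moreover have "((\<lambda>s. z t * exp (N * s)) has_integral z t * exp (N * t) / N - z t * exp (N * 0) / N) {0..t}"
    using t \<open>0 < N\<close>
    by (intro fundamental_theorem_of_calculus)
       (auto intro!: derivative_eq_intros simp flip: has_real_derivative_iff_has_vector_derivative)
  hence "integral {0..t} (\<lambda>s. z t * exp (N * s)) = z t * exp (N * t) / N - z t * exp (N * 0) / N"
    by (rule integral_unique)
  moreover have "0 \<le> z t * exp (N * 0) / N" using \<open>0 < N\<close> by (simp add: z_def)
  ultimately have "\<bar>integral {0..1} f\<bar> \<le> z t * exp (N * t) / N"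
    by (simp only: real_norm_def)
  hence "\<bar>\<nu>\<bar> * \<bar>integral {0..1} f\<bar> \<le> \<bar>\<nu>\<bar> * (z t * exp (N * t) / N)" by (intro mult_left_mono) auto
  hence "\<bar>y t\<bar> \<le> \<bar>\<nu>\<bar> * (z t * exp (N * t) / N)"
    using eq[OF t] by (simp add: f_def abs_mult)
  hence "z t \<le> \<bar>\<nu>\<bar> * (z t * exp (N * t) / N) * exp (- (N * t))"
    unfolding z_def by (intro mult_right_mono) (auto simp: z_def)
  also have "\<dots> = \<bar>\<nu>\<bar> / N * z t" by (simp flip: exp_add)
  finally have "(1 - \<bar>\<nu>\<bar> / N) * z t \<le> 0" by (simp add: algebra_simps)
  moreover have "0 < 1 - \<bar>\<nu>\<bar> / N" using \<open>\<bar>\<nu>\<bar> < N\<close> \<open>0 < N\<close> by simp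
  ultimately have "z t \<le> 0" by (simp add: mult_le_0_iff)
  hence "\<bar>y u\<bar> \<le> 0"
    using y_le[OF assms(4)] by (smt (verit) exp_gt_zero mult_nonpos_nonneg)
  thus ?thesis by simp
qed

text \<open>Near 0 the integral is of order \<open>u powr (1 + \<gamma>)\<close>, which the source
  \<open>A * u powr \<beta>\<close> dominates because \<beta> < 1 + \<gamma>. So \<open>y\<close> is
  positive just to the right of 0, and a later negative value forces a first zero away from
  0.\<close>

lemma riesz_equation_first_zero:
  fixes A \<nu> \<beta> \<gamma> :: real
  assumes "0 < \<gamma>" "0 < \<beta>" "\<beta> \<le> 1" "0 < A" "continuous_on {0..1} y"
    and eq: "\<And>u. u \<in> {0..1} \<Longrightarrow>
      y u = A * u powr \<beta> + \<nu> * integral {0..1} (\<lambda>s. riesz_kernel \<gamma> u s * y s)"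
    and "w \<in> {0..1}" "y w < 0"
  obtains v where "0 < v" "v \<le> 1" "y v = 0" "\<And>u. u \<in> {0..v} \<Longrightarrow> 0 \<le> y u"
proof -
  have "bounded (y ` {0..1})"
    using assms(5) by (intro compact_imp_bounded compact_continuous_image) auto
  then obtain K where "0 < K" "\<forall>z \<in> y ` {0..1}. norm z \<le> K"
    unfolding bounded_pos by blast
  hence K: "\<And>u. u \<in> {0..1} \<Longrightarrow> \<bar>y u\<bar> \<le> K" "0 < K" by simp_all
  have lower: "A * u powr \<beta> - \<bar>\<nu>\<bar> * K * u powr (1 + \<gamma>) \<le> y u" if u: "u \<in> {0..1}" for u
  proof -
    have "norm (integral {0..1} (\<lambda>s. riesz_kernel \<gamma> u s * y s)) \<le> integral {0..1} (\<lambda>s. riesz_kernel \<gamma> u s * K)"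
      using assms(1,5) K by (intro integral_norm_bound_integral integrable_riesz_kernel_mult)
        (auto simp: abs_mult intro!: mult_left_mono continuous_intros)
    also have "\<dots> = u powr (1 + \<gamma>) / (1 + \<gamma>) * K"
      using has_integral_mult_left[OF has_integral_riesz_kernel[of \<gamma> u]] assms(1) u
      by (intro integral_unique) auto
    also have "\<dots> \<le> u powr (1 + \<gamma>) * K"
      using assms(1) K by (intro mult_right_mono) (auto simp: field_simps)
    finally have "\<bar>\<nu>\<bar> * \<bar>integral {0..1} (\<lambda>s. riesz_kernel \<gamma> u s * y s)\<bar> \<le> \<bar>\<nu>\<bar> * (u powr (1 + \<gamma>) * K)"
      by (intro mult_left_mono) auto
    hence "- (\<nu> * integral {0..1} (\<lambda>s. riesz_kernel \<gamma> u s * y s)) \<le> \<bar>\<nu>\<bar> * (u powr (1 + \<gamma>) * K)"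
      by (simp flip: abs_mult)
    thus ?thesis using eq[OF u] by (simp add: mult_ac)
  qed
  define p where "p = 1 + \<gamma> - \<beta>"
  \<comment> \<open>Up to this point \<open>u powr p * (\<bar>\<nu>\<bar> * K + 1) \<le> A\<close>;
    the added 1 makes the domination strict and keeps the denominator positive when \<nu> =
    0.\<close>
  define \<epsilon> where "\<epsilon> = min 1 ((A / (\<bar>\<nu>\<bar> * K + 1)) powr (1 / p))"
  have "0 < p" using assms by (simp add: p_def)
  have D: "0 < \<bar>\<nu>\<bar> * K + 1" using K by (intro add_nonneg_pos) auto
  have \<epsilon>: "0 < \<epsilon>" using assms(4) D by (simp add: \<epsilon>_def)
  have pos: "0 < y u" if u: "0 < u" "u \<le> \<epsilon>" for u
  proof -
    have "u powr p \<le> ((A / (\<bar>\<nu>\<bar> * K + 1)) powr (1 / p)) powr p"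
      using u \<open>0 < p\<close> by (intro powr_mono2) (auto simp: \<epsilon>_def)
    also have "\<dots> = A / (\<bar>\<nu>\<bar> * K + 1)" using \<open>0 < p\<close> assms(4) D by (simp add: powr_powr)
    finally have "u powr p * (\<bar>\<nu>\<bar> * K + 1) \<le> A" using D by (simp add: field_simps)
    moreover have "u powr p * (\<bar>\<nu>\<bar> * K + 1) = u powr p * (\<bar>\<nu>\<bar> * K) + u powr p"
      by (simp add: algebra_simps)
    moreover have "0 < u powr p" using u by simp
    ultimately have "u powr p * (\<bar>\<nu>\<bar> * K) < A" by linarith
    hence "u powr \<beta> * (u powr p * (\<bar>\<nu>\<bar> * K)) < u powr \<beta> * A" using u by (intro mult_strict_left_mono) auto
    moreover have "u powr \<beta> * u powr p = u powr (1 + \<gamma>)" by (simp add: p_def flip: powr_add)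
    ultimately have "\<bar>\<nu>\<bar> * K * u powr (1 + \<gamma>) < A * u powr \<beta>" by (simp add: mult_ac)
    thus ?thesis using lower[of u] u by (auto simp: \<epsilon>_def)
  qed
  \<comment> \<open>Starting at \<epsilon> excludes the trivial zero at 0 and makes the set compact,
    so that it has a least element.\<close>
  define S where "S = {u \<in> {\<epsilon>..1}. y u \<le> 0}"
  have "y 0 = 0" using eq[of 0] riesz_integral_0 by simp
  have "\<epsilon> \<le> w"
    using pos[of w] assms(7,8) \<open>y 0 = 0\<close> by (cases "w = 0") force+
  hence "w \<in> S" using assms(7,8) by (simp add: S_def)
  have "closed S"
    unfolding S_def using \<epsilon> by (intro continuous_on_closed_Collect_le continuous_on_subset[OF assms(5)]) auto
  moreover have "bounded S" by (rule bounded_subset[of "{\<epsilon>..1}"]) (auto simp: S_def)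
  ultimately have "compact S" by (simp add: compact_eq_bounded_closed)
  then obtain v where v: "v \<in> S" "\<And>u. u \<in> S \<Longrightarrow> v \<le> u"
    using compact_attains_inf[of S] \<open>w \<in> S\<close> by auto
  have v01: "0 < v" "v \<le> 1" "y v \<le> 0" using v(1) \<epsilon> by (auto simp: S_def)
  have before: "0 < y u" if "0 < u" "u < v" for u
  proof (cases "u \<le> \<epsilon>")
    case False
    thus ?thesis using v(2)[of u] that v01 by (force simp: S_def)
  qed (use pos that in auto)
  have "0 \<le> y v"
  proof (rule ccontr)
    assume "\<not> 0 \<le> y v"
    \<comment> \<open>A negative value at \<open>v\<close> would produce a zero strictly before
      \<open>v\<close>, where \<open>y\<close> is positive.\<close>
    have "\<exists>x\<ge>v / 2. x \<le> v \<and> y x = 0"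
      using before[of "v / 2"] v01 by (intro IVT2' continuous_on_subset[OF assms(5)]) auto
    then obtain x where "v / 2 \<le> x" "x \<le> v" "y x = 0" by blast
    thus False using before[of x] v01 \<open>\<not> 0 \<le> y v\<close> by (cases "x = v") auto
  qed
  hence "y v = 0" using v01 by simp
  show ?thesis
  proof (rule that[of v])
    fix u assume "u \<in> {0..v}"
    thus "0 \<le> y u"
      using before[of u] \<open>y v = 0\<close> \<open>y 0 = 0\<close> by (cases "u = 0 \<or> u = v") auto
  qed (use v01 \<open>y v = 0\<close> in auto)
qed

text \<open>Rescaling to a first zero \<open>v\<close> multiplies the coefficient by
  \<open>v powr (1 + \<gamma>) \<le> 1\<close>, so \<open>small\<close> survives. The rescaled
  solution vanishes at 1, and \<open>positive_solution_peak_drop\<close> then forces its peak to be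
  0, which contradicts the positive source term.\<close>

lemma riesz_equation_nonneg:
  fixes A \<nu> \<beta> \<gamma> :: real
  assumes "0 < \<gamma>" "\<gamma> \<le> \<beta>" "\<beta> \<le> 1" "0 < A" "continuous_on {0..1} y"
    and eq: "\<And>u. u \<in> {0..1} \<Longrightarrow>
      y u = A * u powr \<beta> + \<nu> * integral {0..1} (\<lambda>s. riesz_kernel \<gamma> u s * y s)"
    and small: "\<bar>\<nu>\<bar> * (\<beta> powr \<beta> * \<gamma> powr \<gamma>) < 1"
    and "u \<in> {0..1}"
  shows "0 \<le> y u"
proof (rule ccontr)
  assume "\<not> 0 \<le> y u"
  with riesz_equation_first_zero[OF assms(1) _ assms(3-6,8)] assms(1,2) obtain v
    where v: "0 < v" "v \<le> 1" "y v = 0" and nonneg: "\<And>u. u \<in> {0..v} \<Longrightarrow> 0 \<le> y u"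
    by (auto simp: not_le)
  define x where "x = (\<lambda>s. y (v * s))"
  define \<mu> where "\<mu> = \<nu> * v powr (1 + \<gamma>)"
  define J where "J = (\<lambda>u. integral {0..1} (\<lambda>s. riesz_kernel \<gamma> u s * x s))"
  have in01: "v * s \<in> {0..v}" "v * s \<in> {0..1}" if "s \<in> {0..1}" for s
    using that v mult_left_mono[of s 1 v] by (auto intro: mult_le_one)
  have cont: "continuous_on {0..1} x"
    unfolding x_def using in01
    by (intro continuous_on_compose2[OF assms(5)] continuous_intros) auto
  have x_nonneg: "0 \<le> x s" if "s \<in> {0..1}" for s
    unfolding x_def using that in01 nonneg by blast
  have x_eq: "x s = A * v powr \<beta> * s powr \<beta> + \<mu> * J s" if s: "s \<in> {0..1}" for s
  proof -
    have "x s = A * (v * s) powr \<beta> + \<nu> * (v powr (1 + \<gamma>) * J s)"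
      unfolding x_def J_def using eq[OF in01(2)[OF s]]
        riesz_integral_scale[OF assms(1,5) v(1,2) s] by simp
    thus ?thesis using v s by (simp add: \<mu>_def powr_mult)
  qed
  have x1: "x 1 = 0" using v by (simp add: x_def)
  have J1: "0 \<le> J 1"
    unfolding J_def using x_nonneg
    by (intro integral_nonneg integrable_riesz_kernel_mult[OF assms(1) cont]) auto
  have "\<mu> < 0"
  proof (rule ccontr)
    assume "\<not> \<mu> < 0"
    hence "0 \<le> \<mu> * J 1" using J1 by simp
    moreover have "0 < A * v powr \<beta>" using assms(4) v by simp
    ultimately show False using x_eq[of 1] x1 by simp
  qed
  obtain t where t: "t \<in> {0..1}" "\<And>u. u \<in> {0..1} \<Longrightarrow> x u \<le> x t"
    using continuous_attains_sup[of "{0..1}" x] cont by auto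
  have "x t - x 1 \<le> (- \<mu>) * (\<beta> powr \<beta> * \<gamma> powr \<gamma>) * x t"
    using \<open>\<mu> < 0\<close> assms(1-4) x_eq unfolding J_def
    by (intro positive_solution_peak_drop[of \<gamma> \<beta> "A * v powr \<beta>"] t cont x_nonneg) auto
  moreover have "(- \<mu>) * (\<beta> powr \<beta> * \<gamma> powr \<gamma>) < 1"
  proof -
    have "\<bar>\<nu>\<bar> * v powr (1 + \<gamma>) \<le> \<bar>\<nu>\<bar> * 1" using v assms(1) by (intro mult_left_mono powr_le1) auto
    moreover have "\<bar>\<mu>\<bar> = \<bar>\<nu>\<bar> * v powr (1 + \<gamma>)" by (simp add: \<mu>_def abs_mult)
    ultimately have "- \<mu> \<le> \<bar>\<nu>\<bar>" by linarith
    hence "(- \<mu>) * (\<beta> powr \<beta> * \<gamma> powr \<gamma>) \<le> \<bar>\<nu>\<bar> * (\<beta> powr \<beta> * \<gamma> powr \<gamma>)"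
      by (intro mult_right_mono) auto
    thus ?thesis using small by linarith
  qed
  ultimately have "(1 - (- \<mu>) * (\<beta> powr \<beta> * \<gamma> powr \<gamma>)) * x t \<le> 0" "0 < 1 - (- \<mu>) * (\<beta> powr \<beta> * \<gamma> powr \<gamma>)"
    using x1 by (simp_all add: algebra_simps)
  hence "x t = 0" using x_nonneg[OF t(1)] by (simp add: mult_le_0_iff)
  hence "x s = 0" if "s \<in> {0..1}" for s using t(2)[OF that] x_nonneg[OF that] by simp
  hence "J 1 = integral {0..1} (\<lambda>s::real. 0::real)"
    unfolding J_def by (intro integral_cong) auto
  thus False using x_eq[of 1] x1 assms(4) v by simp
qed

section \<open>The eigenvalue bound in normalized form\<close>

lemma riesz_equation_bound:
  fixes A \<nu> \<beta> \<gamma> \<kappa> :: real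
  assumes "0 < \<gamma>" "\<gamma> \<le> \<beta>" "\<beta> \<le> 1" "0 \<le> \<kappa>" "\<kappa> < 1" "continuous_on {0..1} y"
    and eq: "\<And>u. u \<in> {0..1} \<Longrightarrow>
      y u = A * u powr \<beta> + \<nu> * integral {0..1} (\<lambda>s. riesz_kernel \<gamma> u s * y s)"
    and t: "t \<in> {0..1}" "\<And>u. u \<in> {0..1} \<Longrightarrow> \<bar>y u\<bar> \<le> \<bar>y t\<bar>" "y t \<noteq> 0"
    and "\<bar>y 1\<bar> \<le> \<kappa> * \<bar>y t\<bar>"
  shows "1 - \<kappa> \<le> \<bar>\<nu>\<bar> * (\<beta> powr \<beta> * \<gamma> powr \<gamma>)"
proof (rule ccontr)
  assume "\<not> 1 - \<kappa> \<le> \<bar>\<nu>\<bar> * (\<beta> powr \<beta> * \<gamma> powr \<gamma>)"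
  hence small: "\<bar>\<nu>\<bar> * (\<beta> powr \<beta> * \<gamma> powr \<gamma>) < 1 - \<kappa>" by simp
  \<comment> \<open>Without a source the equation is homogeneous, and its only continuous solution
    is zero.\<close>
  have "A \<noteq> 0"
    using riesz_equation_zero[OF assms(1,6) _ t(1), of \<nu>] eq t(3) by auto
  \<comment> \<open>Multiplying by the sign of \<open>A\<close> makes the source coefficient
    positive and preserves absolute values.\<close>
  define x where "x = (\<lambda>u. sgn A * y u)"
  have cont: "continuous_on {0..1} x" unfolding x_def using assms(6) by (intro continuous_intros)
  have abs_x: "\<bar>x u\<bar> = \<bar>y u\<bar>" for u using \<open>A \<noteq> 0\<close> by (simp add: x_def abs_mult abs_sgn_eq)
  have x_eq: "x u = \<bar>A\<bar> * u powr \<beta> + \<nu> * integral {0..1} (\<lambda>s. riesz_kernel \<gamma> u s * x s)"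
    if "u \<in> {0..1}" for u
  proof -
    have "integral {0..1} (\<lambda>s. riesz_kernel \<gamma> u s * x s) =
          sgn A * integral {0..1} (\<lambda>s. riesz_kernel \<gamma> u s * y s)"
      unfolding x_def by (subst integral_mult_right[symmetric]) (simp add: mult_ac)
    thus ?thesis unfolding x_def eq[OF that] by (simp add: algebra_simps abs_sgn)
  qed
  have nonneg: "0 \<le> x u" if "u \<in> {0..1}" for u
    using \<open>A \<noteq> 0\<close> small assms(4)
    by (intro riesz_equation_nonneg[OF assms(1-3) _ cont x_eq _ that]) auto
  have max: "x u \<le> x t" if "u \<in> {0..1}" for u
    using t(2)[OF that] nonneg[OF that] nonneg[OF t(1)] abs_x[of u] abs_x[of t] by simp
  have x1: "x 1 \<le> \<kappa> * x t"
    using assms(11) nonneg[of 1] nonneg[OF t(1)] abs_x[of 1] abs_x[of t] by simp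
  have X: "0 < x t" using nonneg[OF t(1)] t(3) abs_x[of t] by auto
  have "\<nu> < 0"
  proof (rule ccontr)
    assume "\<not> \<nu> < 0"
    have "integral {0..1} (\<lambda>s. riesz_kernel \<gamma> t s * x s) \<le> integral {0..1} (\<lambda>s. riesz_kernel \<gamma> 1 s * x s)"
      using assms(1) t(1) nonneg
      by (intro integral_le integrable_riesz_kernel_mult cont mult_right_mono riesz_kernel_mono) auto
    hence "\<nu> * integral {0..1} (\<lambda>s. riesz_kernel \<gamma> t s * x s) \<le> \<nu> * integral {0..1} (\<lambda>s. riesz_kernel \<gamma> 1 s * x s)"
      using \<open>\<not> \<nu> < 0\<close> by (intro mult_left_mono) auto
    moreover have "\<bar>A\<bar> * t powr \<beta> \<le> \<bar>A\<bar> * 1"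
      using t(1) assms(1,2) by (intro mult_left_mono powr_le1) auto
    ultimately have "x t \<le> x 1" using x_eq[of 1] x_eq[OF t(1)] by simp
    moreover have "\<kappa> * x t < 1 * x t" using assms(5) X by (intro mult_strict_right_mono) auto
    ultimately show False using x1 by simp
  qed
  have "x t - x 1 \<le> (- \<nu>) * (\<beta> powr \<beta> * \<gamma> powr \<gamma>) * x t"
    using \<open>\<nu> < 0\<close> x_eq
    by (intro positive_solution_peak_drop[OF assms(1-3), of "\<bar>A\<bar>"] cont nonneg t(1) max) auto
  moreover have "\<bar>\<nu>\<bar> * (\<beta> powr \<beta> * \<gamma> powr \<gamma>) * x t < (1 - \<kappa>) * x t"
    using small X by (rule mult_strict_right_mono)
  ultimately show False using \<open>\<nu> < 0\<close> x1 by (simp add: algebra_simps)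
qed

subsection \<open>Eigenvalues\<close>

text \<open>In the variable \<open>p\<close> every difference of \<psi>-values is \<open>L\<close>
  times a difference in [0,1], and the clipping in \<open>riesz_kernel\<close> absorbs the case
  distinction of \<open>green\<close>. The last assumption is the monotonicity of \<psi>, asked only
  at the two points involved.\<close>

lemma green_eq_riesz_kernel:
  fixes \<psi> :: "real \<Rightarrow> real"
  assumes "\<psi> a < \<psi> b" "\<psi> a \<le> \<psi> t" "\<psi> \<tau> \<le> \<psi> b" "\<tau> \<le> t \<longleftrightarrow> \<psi> \<tau> \<le> \<psi> t"
  defines "L \<equiv> \<psi> b - \<psi> a"
  defines "p \<equiv> \<lambda>t. (\<psi> t - \<psi> a) / L"
  shows "green a b \<alpha> \<beta> \<psi> \<tau> t = L powr (\<alpha> + \<beta> - 1) / Gamma (\<alpha> + \<beta>) *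
    (p t powr \<beta> * riesz_kernel (\<alpha> + \<beta> - 1) 1 (p \<tau>) - riesz_kernel (\<alpha> + \<beta> - 1) (p t) (p \<tau>))"
proof -
  define \<gamma> where "\<gamma> = \<alpha> + \<beta> - 1"
  have "0 < L" using assms by (simp add: L_def)
  have \<psi>: "\<psi> s = \<psi> a + L * p s" for s using \<open>0 < L\<close> by (simp add: p_def)
  have p: "0 \<le> p t" "p \<tau> \<le> 1"
    using assms(2,3) \<open>0 < L\<close> by (auto simp: p_def L_def field_simps)
  have le: "\<tau> \<le> t \<longleftrightarrow> p \<tau> \<le> p t" unfolding assms(4) p_def using \<open>0 < L\<close> by (simp add: divide_le_cancel)
  have "L * (1 - p \<tau>) = L - L * p \<tau>" by (simp add: algebra_simps)
  hence b: "\<psi> b - \<psi> \<tau> = L * (1 - p \<tau>)" using \<psi>[of \<tau>] L_def by linarith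
  have C: "1 / (Gamma (\<alpha> + \<beta>) * (\<psi> b - \<psi> a) powr \<beta>) * (\<psi> t - \<psi> a) powr \<beta> * (\<psi> b - \<psi> \<tau>) powr \<gamma> =
    L powr \<gamma> / Gamma (\<alpha> + \<beta>) * (p t powr \<beta> * riesz_kernel \<gamma> 1 (p \<tau>))"
    unfolding b \<psi>[of t] using \<open>0 < L\<close> p by (simp add: powr_mult riesz_kernel_def flip: L_def)
  have D: "1 / Gamma (\<alpha> + \<beta>) * (\<psi> t - \<psi> \<tau>) powr \<gamma> = L powr \<gamma> / Gamma (\<alpha> + \<beta>) * riesz_kernel \<gamma> (p t) (p \<tau>)"
    if "p \<tau> \<le> p t"
  proof -
    have "\<psi> t - \<psi> \<tau> = L * (p t - p \<tau>)" unfolding \<psi>[of t] \<psi>[of \<tau>] by (simp add: algebra_simps)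
    thus ?thesis using \<open>0 < L\<close> that by (simp add: powr_mult riesz_kernel_def)
  qed
  show ?thesis
    unfolding green_def Let_def le \<gamma>_def[symmetric] C
    using D by (auto simp: right_diff_distrib riesz_kernel_eq_0)
qed

theorem corollary4p6:
  fixes a b \<alpha> \<beta> \<kappa> lam :: real
    and \<psi> \<psi>' :: "real \<Rightarrow> real"
    and \<G> :: "(real \<Rightarrow> real) \<Rightarrow> real"
  assumes "a < b"
    and "0 < \<alpha>" and "\<alpha> \<le> 1" and "0 < \<beta>" and "\<beta> \<le> 1" and "\<alpha> + \<beta> > 1"
    and "\<And>t. t \<in> {a..b} \<Longrightarrow> (\<psi> has_real_derivative \<psi>' t) (at t within {a..b})"
    and "continuous_on {a..b} \<psi>'"
    and "\<And>t. t \<in> {a..b} \<Longrightarrow> \<psi>' t > 0"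
    and "0 < \<kappa>" and "\<kappa> < 1"
    and "\<And>x. x \<in> C_space a b \<Longrightarrow> \<bar>\<G> x\<bar> \<le> \<kappa> * sup_norm a b x"
    and "is_eigenvalue a b \<alpha> \<beta> \<psi> \<psi>' \<G> lam"
  shows "\<bar>lam\<bar> \<ge> (1 - \<kappa>) / (G_max a b \<alpha> \<beta> \<psi> * (\<psi> b - \<psi> a))"
proof -
  define \<gamma> where "\<gamma> = \<alpha> + \<beta> - 1"
  define L where "L = \<psi> b - \<psi> a"
  define p where "p = (\<lambda>t. (\<psi> t - \<psi> a) / L)"
  \<comment> \<open>The Green function contributes \<open>L powr \<gamma>\<close> and the
    substitution \<open>\<psi>' = L * p'\<close> one more factor \<open>L\<close>. The minus sign of
    the nonlinearity cancels the one in front of the Volterra part of the Green function.\<close>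
  define \<nu> where "\<nu> = lam * (L powr (1 + \<gamma>) / Gamma (\<alpha> + \<beta>))"
  note deriv = assms(7)
  have \<gamma>: "0 < \<gamma>" "\<gamma> \<le> \<beta>" using assms(3,6) by (auto simp: \<gamma>_def)
  obtain x where x: "x \<in> C_space a b" and nontriv: "\<exists>t\<in>{a..b}. x t \<noteq> 0"
    and mild: "\<And>t. t \<in> {a..b} \<Longrightarrow> x t = ((\<psi> t - \<psi> a) / (\<psi> b - \<psi> a)) powr \<beta> * \<G> x
      + integral {a..b} (\<lambda>\<tau>. green a b \<alpha> \<beta> \<psi> \<tau> t * \<psi>' \<tau> * (- lam * x \<tau>))"
    using assms(13) unfolding is_eigenvalue_def mild_solution_def by blast
  have cont_x: "continuous_on {a..b} x" using x by (simp add: C_space_def)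
  have cont_\<psi>: "continuous_on {a..b} \<psi>" using deriv by (intro DERIV_continuous_on)
  have \<psi>_less: "\<psi> s < \<psi> t" if "s \<in> {a..b}" "t \<in> {a..b}" "s < t" for s t
  proof (rule DERIV_pos_imp_increasing_open[OF that(3)])
    fix r assume r: "s < r" "r < t"
    hence "r \<in> {a..b}" "at r within {a..b} = at r"
      using that by (auto intro!: at_within_interior)
    thus "\<exists>y. (\<psi> has_real_derivative y) (at r) \<and> 0 < y"
      using deriv[of r] assms(9)[of r] by auto
  qed (use that in \<open>auto intro: continuous_on_subset[OF cont_\<psi>]\<close>)
  have \<psi>_le_iff: "s \<le> t \<longleftrightarrow> \<psi> s \<le> \<psi> t" if "s \<in> {a..b}" "t \<in> {a..b}" for s t
    using \<psi>_less[of s t] \<psi>_less[of t s] that by (metis linorder_not_le order.strict_iff_order order_le_less)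
  have L: "0 < L" using \<psi>_less[of a b] assms(1) by (simp add: L_def)
  have p_ends: "p a = 0" "p b = 1" using L by (auto simp: p_def L_def)
  have p_less: "p s < p t" if "s \<in> {a..b}" "t \<in> {a..b}" "s < t" for s t
    using \<psi>_less[OF that] L by (simp add: p_def divide_strict_right_mono)
  have p_le: "p s \<le> p t" if "s \<in> {a..b}" "t \<in> {a..b}" "s \<le> t" for s t
    using \<psi>_le_iff[OF that(1,2)] that(3) L by (simp add: p_def divide_right_mono)
  have cont_p: "continuous_on {a..b} p"
    unfolding p_def using cont_\<psi> L by (intro continuous_intros) auto
  have p_in: "p t \<in> {0..1}" if "t \<in> {a..b}" for t
    using p_le[of a t] p_le[of t b] that assms(1) by (simp add: p_ends)
  have p_onto: "p ` {a..b} = {0..1}"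
  proof (intro equalityI subsetI)
    fix u :: real assume "u \<in> {0..1}"
    thus "u \<in> p ` {a..b}"
      using IVT'[of p a u b] assms(1) cont_p by (auto simp: p_ends)
  qed (use p_in in auto)
  have "inj_on p {a..b}"
    by (rule linorder_inj_onI) (use p_less in \<open>force+\<close>)
  define g where "g = inv_into {a..b} p"
  have g_p: "g (p t) = t" if "t \<in> {a..b}" for t
    using \<open>inj_on p {a..b}\<close> that by (simp add: g_def)
  have p_g: "p (g u) = u" "g u \<in> {a..b}" if "u \<in> {0..1}" for u
    using that p_onto f_inv_into_f[of u p "{a..b}"] inv_into_into[of u p "{a..b}"] by (simp_all add: g_def)
  have cont_g: "continuous_on {0..1} g"
    using continuous_on_inv[OF cont_p compact_Icc] g_p by (simp add: p_onto)
  define y where "y = (\<lambda>u. x (g u))"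
  have cont_y: "continuous_on {0..1} y"
    unfolding y_def by (rule continuous_on_compose2[OF cont_x cont_g]) (use p_g in auto)
  define J where "J = (\<lambda>u. integral {0..1} (\<lambda>s. riesz_kernel \<gamma> u s * y s))"
  \<comment> \<open>The part of the Green function with the kernel at 1 yields a constant times
    \<open>u powr \<beta>\<close>, so it merges with the boundary term into a single source
    coefficient. At \<open>u = 1\<close> the two integrals cancel and leave
    \<open>\<G> x\<close>.\<close>
  have y_eq: "y u = (\<G> x - \<nu> * J 1) * u powr \<beta> + \<nu> * J u" if u: "u \<in> {0..1}" for u
  proof -
    define t where "t = g u"
    have t: "t \<in> {a..b}" "p t = u" using p_g[OF u] by (auto simp: t_def)
    define f where "f = (\<lambda>s. (u powr \<beta> * riesz_kernel \<gamma> 1 s - riesz_kernel \<gamma> u s) * y s)"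
    have cont_f: "continuous_on {0..1} f"
      unfolding f_def using cont_y \<gamma> by (intro continuous_intros)
    have "((\<lambda>\<tau>. (\<psi>' \<tau> / L) *\<^sub>R f (p \<tau>)) has_integral integral {p a..p b} f) {a..b}"
    proof (rule has_integral_substitution[where c = 0 and d = 1])
      fix \<tau> assume "\<tau> \<in> {a..b}"
      from deriv[OF this] show "(p has_real_derivative \<psi>' \<tau> / L) (at \<tau> within {a..b})"
        unfolding p_def using L by (auto intro!: derivative_eq_intros)
    qed (use assms(1) p_in cont_f in \<open>auto simp: p_ends\<close>)
    hence int: "((\<lambda>\<tau>. - \<nu> * ((\<psi>' \<tau> / L) *\<^sub>R f (p \<tau>))) has_integral - \<nu> * integral {0..1} f) {a..b}"
      unfolding p_ends by (rule has_integral_mult_right)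
    have integrand: "green a b \<alpha> \<beta> \<psi> \<tau> t * \<psi>' \<tau> * (- lam * x \<tau>) = - \<nu> * ((\<psi>' \<tau> / L) *\<^sub>R f (p \<tau>))"
      if \<tau>: "\<tau> \<in> {a..b}" for \<tau>
    proof -
      have "green a b \<alpha> \<beta> \<psi> \<tau> t = L powr \<gamma> / Gamma (\<alpha> + \<beta>) *
        (u powr \<beta> * riesz_kernel \<gamma> 1 (p \<tau>) - riesz_kernel \<gamma> u (p \<tau>))"
        unfolding \<gamma>_def t(2)[symmetric] p_def L_def
        using assms(1,6) t(1) \<tau> \<psi>_less[of a b] \<psi>_le_iff[of a t] \<psi>_le_iff[of \<tau> b]
        by (intro green_eq_riesz_kernel \<psi>_le_iff) auto
      moreover have "f (p \<tau>) = (u powr \<beta> * riesz_kernel \<gamma> 1 (p \<tau>) - riesz_kernel \<gamma> u (p \<tau>)) * x \<tau>"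
        using g_p[OF \<tau>] by (simp add: f_def y_def)
      moreover have "L powr (1 + \<gamma>) = L * L powr \<gamma>" using L by (simp add: powr_add)
      ultimately show ?thesis using L by (simp add: \<nu>_def)
    qed
    have "((\<lambda>\<tau>. green a b \<alpha> \<beta> \<psi> \<tau> t * \<psi>' \<tau> * (- lam * x \<tau>)) has_integral
      - \<nu> * integral {0..1} f) {a..b}"
      using int by (rule has_integral_eq[rotated]) (simp only: integrand)
    hence "integral {a..b} (\<lambda>\<tau>. green a b \<alpha> \<beta> \<psi> \<tau> t * \<psi>' \<tau> * (- lam * x \<tau>)) = - \<nu> * integral {0..1} f"
      by (rule integral_unique)
    moreover have "integral {0..1} f = u powr \<beta> * J 1 - J u"
    proof -
      note int = integrable_riesz_kernel_mult[OF \<gamma>(1) cont_y, THEN integrable_integral]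
      have "((\<lambda>s. u powr \<beta> * (riesz_kernel \<gamma> 1 s * y s) - riesz_kernel \<gamma> u s * y s) has_integral
        u powr \<beta> * J 1 - J u) {0..1}"
        unfolding J_def by (intro has_integral_diff has_integral_mult_right int)
      thus ?thesis by (intro integral_unique) (simp add: f_def algebra_simps)
    qed
    moreover have "y u = x t" by (simp add: y_def t_def)
    ultimately show ?thesis
      using mild[OF t(1)] t(2) by (simp add: p_def L_def algebra_simps)
  qed
  obtain t where t: "t \<in> {0..1}" "\<And>u. u \<in> {0..1} \<Longrightarrow> \<bar>y u\<bar> \<le> \<bar>y t\<bar>"
    using continuous_attains_sup[of "{0..1}" "\<lambda>u. \<bar>y u\<bar>"] continuous_on_rabs[OF cont_y] by auto
  have x_le: "\<bar>x s\<bar> \<le> \<bar>y t\<bar>" if "s \<in> {a..b}" for s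
    using t(2)[OF p_in[OF that]] g_p[OF that] by (simp add: y_def)
  hence "y t \<noteq> 0" using nontriv by force
  have "sup_norm a b x = \<bar>y t\<bar>"
    unfolding sup_norm_def
    by (rule cSup_eq_maximum) (use p_g(2)[OF t(1)] x_le in \<open>auto simp: y_def\<close>)
  moreover have "y 1 = \<G> x" using y_eq[of 1] by simp
  ultimately have "\<bar>y 1\<bar> \<le> \<kappa> * \<bar>y t\<bar>" using assms(12)[OF x] by simp
  hence "1 - \<kappa> \<le> \<bar>\<nu>\<bar> * (\<beta> powr \<beta> * \<gamma> powr \<gamma>)"
    using assms(5,10,11) \<gamma> y_eq t \<open>y t \<noteq> 0\<close> unfolding J_def
    by (intro riesz_equation_bound[OF _ _ _ _ _ cont_y]) auto
  also have "\<dots> = \<bar>lam\<bar> * (L powr (1 + \<gamma>) / Gamma (\<alpha> + \<beta>) * (\<beta> powr \<beta> * \<gamma> powr \<gamma>))"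
    using assms(6) by (simp add: \<nu>_def abs_mult Gamma_real_pos)
  also have "\<dots> \<le> \<bar>lam\<bar> * (G_max a b \<alpha> \<beta> \<psi> * (\<psi> b - \<psi> a))"
  proof (rule mult_left_mono)
    define m where "m = max (\<beta> powr \<beta> * \<gamma> powr \<gamma>)
      (\<beta> * \<gamma> powr (\<gamma> / \<beta>) / (\<alpha> + 2 * \<beta> - 1) powr ((\<alpha> + 2 * \<beta> - 1) / \<beta>))"
    have "G_max a b \<alpha> \<beta> \<psi> * (\<psi> b - \<psi> a) = 1 / Gamma (\<alpha> + \<beta>) * L powr \<gamma> * m * L"
      by (simp add: G_max_def m_def L_def \<gamma>_def)
    also have "\<dots> = L powr (1 + \<gamma>) / Gamma (\<alpha> + \<beta>) * m" using L by (simp add: powr_add)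
    also have "\<dots> \<ge> L powr (1 + \<gamma>) / Gamma (\<alpha> + \<beta>) * (\<beta> powr \<beta> * \<gamma> powr \<gamma>)"
      using assms(6) by (intro mult_left_mono) (auto simp: m_def intro!: Gamma_real_nonneg)
    finally show "L powr (1 + \<gamma>) / Gamma (\<alpha> + \<beta>) * (\<beta> powr \<beta> * \<gamma> powr \<gamma>) \<le>
      G_max a b \<alpha> \<beta> \<psi> * (\<psi> b - \<psi> a)" .
  qed simp
  finally have *: "1 - \<kappa> \<le> \<bar>lam\<bar> * (G_max a b \<alpha> \<beta> \<psi> * (\<psi> b - \<psi> a))" .
  \<comment> \<open>Since 1 - \<kappa> > 0, the inequality just obtained itself shows that the
    denominator is positive.\<close>
  moreover have "0 < \<bar>lam\<bar> * (G_max a b \<alpha> \<beta> \<psi> * (\<psi> b - \<psi> a))" using * assms(11) by linarith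
  hence "0 < G_max a b \<alpha> \<beta> \<psi> * (\<psi> b - \<psi> a)" by (simp add: zero_less_mult_iff)
  ultimately show ?thesis by (simp add: pos_divide_le_eq)
qed

end
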